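(* Let $d\in\{2,3\}$, let $N\ge 1$ be an integer, let $0<\rho\le 1$ and $M>0$. Assume: (1) For every $1\le m\le N$, $K_m:\mathbb{R}^d\to\mathbb{R}$ is nontrivial (not identically zero) with $K_m,\Delta K_m\in L^1(\mathbb{R}^d)$; $u_{0,m}:\mathbb{R}^d\to\mathbb{R}$ belongs to $H^2(\mathbb{R}^d)$, and for some $1\le m\le N$ the function $u_{0,m}$ does not vanish identically in $\mathbb{R}^d$; and $T_m:H^2(\mathbb{R}^d)\to H^2(\mathbb{R}^d)$ is a bounded linear operator with norm $0<\|T_m\|<\infty$. (2) For each $j=1,2$, $g_j=(g_{j,1},\dots,g_{j,N})$ with $g_{j,m}:\mathbb{R}^N\to\mathbb{R}$, $g_{j,m}(0)=0$ for $1\le m\le N$, and $g_j$ restricted to the ball $I$ belongs to $D_M$ and does not vanish identically in $I$. (3) $$c_a M\big(\|u_0\|_{H^2(\mathbb{R}^d,\mathbb{R}^N)}+1\big)^2 Q\le \frac{\rho}{2}.$$ For $j=1,2$ let $u_{p,j}$ be the unique fixed point of the map $t_{g_j}:B_\rho\to B_\rho$, and let $$u_j(x)=u_0(x)+u_{p,j}(x)$$ be the resulting solution of the system $u_m(x)=u_{0,m}(x)+[T_mu_m](x)\int_{\mathbb{R}^d}K_m(x-y)g_{j,m}(u(y))\,dy$, $1\le m\le N$. Then $$\|u_1-u_2\|_{H^2(\mathbb{R}^d,\mathbb{R}^N)}\le\frac{\sigma}{2M(1-\sigma)}\big(\|u_0\|_{H^2(\mathbb{R}^d,\mathbb{R}^N)}+1\big)\|g_1-g_2\|_{C^1(I,\mathbb{R}^N)},$$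 where $$\sigma:=2c_aQM\big(\|u_0\|_{H^2(\mathbb{R}^d,\mathbb{R}^N)}+1\big).$$
   Context: Here $d\in\{2,3\}$ and $N\ge1$ is an integer. Spaces and norms. $H^2(\mathbb{R}^d)$ is the space of real-valued $\phi\in L^2(\mathbb{R}^d)$ with $\Delta\phi\in L^2(\mathbb{R}^d)$, with norm $\|\phi\|_{H^2(\mathbb{R}^d)}^2:=\|\phi\|_{L^2(\mathbb{R}^d)}^2+\|\Delta\phi\|_{L^2(\mathbb{R}^d)}^2$. For a vector function $u=(u_1,\dots,u_N)^T$, $\|u\|_{H^2(\mathbb{R}^d,\mathbb{R}^N)}^2:=\sum_{m=1}^N\|u_m\|_{L^2(\mathbb{R}^d)}^2+\sum_{m=1}^N\|\Delta u_m\|_{L^2(\mathbb{R}^d)}^2$. $\|T_m\|$ is the operator norm of $T_m$ on $H^2(\mathbb{R}^d)$. We write $u_0=(u_{0,1},\dots,u_{0,N})^T$. Constants. $c_e>0$ is a (fixed) constant such that $\|\phi\|_{L^\infty(\mathbb{R}^d)}\le c_e\|\phi\|_{H^2(\mathbb{R}^d)}$ for all $\phi\in H^2(\mathbb{R}^d)$ (Sobolev embedding). $c_a>0$ is a (fixed) constant such that for all $\phi_1,\phi_2\in H^2(\mathbb{R}^d)$ one has $\phi_1\phi_2\in H^2(\mathbb{R}^d)$ and $\|\phi_1\phi_2\|_{H^2(\mathbb{R}^d)}\le c_a\|\phi_1\|_{H^2(\mathbb{R}^d)}\|\phi_2\|_{H^2(\mathbb{R}^d)}$ (algebra property). Further notation.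 $\|K_m\|_{\tilde W^{2,1}(\mathbb{R}^d)}:=\sqrt{\|K_m\|_{L^1(\mathbb{R}^d)}^2+\|\Delta K_m\|_{L^1(\mathbb{R}^d)}^2}$ and $Q:=\sqrt{\sum_{m=1}^N\|T_m\|^2\|K_m\|_{\tilde W^{2,1}(\mathbb{R}^d)}^2}$. $B_\rho:=\{u\in H^2(\mathbb{R}^d,\mathbb{R}^N): \|u\|_{H^2(\mathbb{R}^d,\mathbb{R}^N)}\le\rho\}$, where $0<\rho\le1$. $I:=\{z\in\mathbb{R}^N: |z|_{\mathbb{R}^N}\le c_e(\|u_0\|_{H^2(\mathbb{R}^d,\mathbb{R}^N)}+1)\}$. $\|g\|_{C^1(I,\mathbb{R}^N)}:=\sum_{m=1}^N\|g_m\|_{C^1(I)}$ with $\|g_m\|_{C^1(I)}:=\|g_m\|_{C(I)}+\sum_{n=1}^N\left\|\frac{\partial g_m}{\partial z_n}\right\|_{C(I)}$ and $\|\phi\|_{C(I)}:=\max_{z\in I}|\phi(z)|$. For $M>0$, $D_M:=\{g=(g_1,\dots,g_N)\in C^1(I,\mathbb{R}^N): \|g\|_{C^1(I,\mathbb{R}^N)}\le M\}$. The map $t_g$. For $g=(g_1,\dots,g_N)$ and $v\in B_\rho$, $t_gv:=u=(u_1,\dots,u_N)^T$ with $u_m(x)=[T_m(u_{0,m}+v_m)](x)\int_{\mathbb{R}^d}K_m(x-y)\,g_m(u_0(y)+v(y))\,dy$, $1\le m\le N$. Under hypotheses (1)–(3) of the claim, it is known that, for each $j=1,2$, $t_{g_j}$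 maps $B_\rho$ into itself and is a strict contraction in the norm of $H^2(\mathbb{R}^d,\mathbb{R}^N)$, so it has a unique fixed point in $B_\rho$. *)

theory Defs
  imports "HOL-Analysis.Analysis" "HOL-Probability.Essential_Supremum"
begin

text \<open>
  Elements of \<open>L\<^sup>1\<close>, \<open>L\<^sup>2\<close>, \<open>H\<^sup>2\<close> are represented by Lebesgue measurable functions on \<open>real^'d\<close>.
  Two representatives are identified when they agree almost everywhere, so equalities between
  elements of these spaces are stated with \<open>AE x in lebesgue\<close>.
\<close>

section \<open>The weak Laplacian\<close>

definition partial :: "'n::finite \<Rightarrow> (real^'n \<Rightarrow> real) \<Rightarrow> real^'n \<Rightarrow> real" where
  "partial i f x = frechet_derivative f (at x) (axis i 1)"

text \<open>If all iterated partial derivatives are differentiable, they are all continuous, so the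
  following is the usual notion of a \<open>C\<^sup>\<infinity>\<close> function.\<close>

definition smooth :: "(real^'n::finite \<Rightarrow> real) \<Rightarrow> bool" where
  "smooth f \<longleftrightarrow> (\<forall>is :: 'n list. (foldr partial is f) differentiable_on UNIV)"

definition test_function :: "(real^'n::finite \<Rightarrow> real) \<Rightarrow> bool" where
  "test_function \<eta> \<longleftrightarrow> smooth \<eta> \<and> compact (closure {x. \<eta> x \<noteq> 0})"

definition classical_laplacian :: "(real^'n::finite \<Rightarrow> real) \<Rightarrow> real^'n \<Rightarrow> real" where
  "classical_laplacian \<eta> x = (\<Sum>i\<in>UNIV. partial i (partial i \<eta>) x)"

definition locally_integrable :: "(real^'n::finite \<Rightarrow> real) \<Rightarrow> bool" where
  "locally_integrable f \<longleftrightarrow> (\<forall>C. compact C \<longrightarrow> f absolutely_integrable_on C)"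

definition has_weak_laplacian ::
  "(real^'n::finite \<Rightarrow> real) \<Rightarrow> (real^'n \<Rightarrow> real) \<Rightarrow> bool" (infix "has'_weak'_laplacian" 50) where
  "\<phi> has_weak_laplacian f \<longleftrightarrow>
     locally_integrable \<phi> \<and> locally_integrable f \<and>
     (\<forall>\<eta>. test_function \<eta> \<longrightarrow>
        (LINT x|lebesgue. \<phi> x * classical_laplacian \<eta> x) = (LINT x|lebesgue. f x * \<eta> x))"

text \<open>The weak Laplacian is determined up to null sets, so the choice of the representative is
  immaterial.\<close>

definition laplacian :: "(real^'n::finite \<Rightarrow> real) \<Rightarrow> real^'n \<Rightarrow> real" where
  "laplacian \<phi> = (SOME f. \<phi> has_weak_laplacian f)"

section \<open>Function spaces on \<open>real^'d\<close>\<close>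

definition L1 :: "(real^'d::finite \<Rightarrow> real) set" where
  "L1 = {f. integrable lebesgue f}"

definition L1_norm :: "(real^'d::finite \<Rightarrow> real) \<Rightarrow> real" where
  "L1_norm f = (LINT x|lebesgue. \<bar>f x\<bar>)"

definition L2 :: "(real^'d::finite \<Rightarrow> real) set" where
  "L2 = {f. f \<in> borel_measurable lebesgue \<and> integrable lebesgue (\<lambda>x. (f x)\<^sup>2)}"

definition L2_norm :: "(real^'d::finite \<Rightarrow> real) \<Rightarrow> real" where
  "L2_norm f = sqrt (LINT x|lebesgue. (f x)\<^sup>2)"

definition H2 :: "(real^'d::finite \<Rightarrow> real) set" where
  "H2 = {\<phi> \<in> L2. \<exists>f \<in> L2. \<phi> has_weak_laplacian f}"

definition H2_norm :: "(real^'d::finite \<Rightarrow> real) \<Rightarrow> real" where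
  "H2_norm \<phi> = sqrt ((L2_norm \<phi>)\<^sup>2 + (L2_norm (laplacian \<phi>))\<^sup>2)"

definition vec_H2 :: "(real^'d::finite \<Rightarrow> real^'N::finite) set" where
  "vec_H2 = {u. \<forall>m. (\<lambda>x. u x $ m) \<in> H2}"

definition vec_H2_norm :: "(real^'d::finite \<Rightarrow> real^'N::finite) \<Rightarrow> real" where
  "vec_H2_norm u = sqrt ((\<Sum>m\<in>UNIV. (L2_norm (\<lambda>x. u x $ m))\<^sup>2)
                       + (\<Sum>m\<in>UNIV. (L2_norm (laplacian (\<lambda>x. u x $ m)))\<^sup>2))"

definition W21 :: "(real^'d::finite \<Rightarrow> real) set" where
  "W21 = {f \<in> L1. \<exists>h \<in> L1. f has_weak_laplacian h}"

definition W21_norm :: "(real^'d::finite \<Rightarrow> real) \<Rightarrow> real" where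
  "W21_norm f = sqrt ((L1_norm f)\<^sup>2 + (L1_norm (laplacian f))\<^sup>2)"

section \<open>Bounded linear operators on \<open>H\<^sup>2\<close>\<close>

text \<open>The conditions imply that \<open>T\<close> respects almost-everywhere equality: if \<open>\<phi> = \<psi>\<close> a.e., then
  \<open>T \<phi> - T \<psi> = T (\<phi> - \<psi>)\<close> a.e. and the right-hand side has norm at most \<open>C * 0\<close>.
  Hence they describe exactly the bounded linear operators on the space of equivalence classes.\<close>

definition H2_bounded_linear :: "((real^'d::finite \<Rightarrow> real) \<Rightarrow> (real^'d \<Rightarrow> real)) \<Rightarrow> bool" where
  "H2_bounded_linear T \<longleftrightarrow>
     (\<forall>\<phi>\<in>H2. T \<phi> \<in> H2) \<and>
     (\<forall>\<phi>\<in>H2. \<forall>\<psi>\<in>H2. AE x in lebesgue. T (\<lambda>y. \<phi> y + \<psi> y) x = T \<phi> x + T \<psi> x) \<and>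
     (\<forall>c. \<forall>\<phi>\<in>H2. AE x in lebesgue. T (\<lambda>y. c * \<phi> y) x = c * T \<phi> x) \<and>
     (\<exists>C. \<forall>\<phi>\<in>H2. H2_norm (T \<phi>) \<le> C * H2_norm \<phi>)"

text \<open>As in \<^const>\<open>onorm\<close>, elements of norm \<open>0\<close> contribute the value \<open>0\<close> to the supremum.\<close>

definition H2_onorm :: "((real^'d::finite \<Rightarrow> real) \<Rightarrow> (real^'d \<Rightarrow> real)) \<Rightarrow> real" where
  "H2_onorm T = (SUP \<phi>\<in>H2. H2_norm (T \<phi>) / H2_norm \<phi>)"

definition Q_const ::
  "('N::finite \<Rightarrow> (real^'d::finite \<Rightarrow> real) \<Rightarrow> (real^'d \<Rightarrow> real)) \<Rightarrow>
   ('N \<Rightarrow> real^'d \<Rightarrow> real) \<Rightarrow> real" where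
  "Q_const T K = sqrt (\<Sum>m\<in>UNIV. (H2_onorm (T m))\<^sup>2 * (W21_norm (K m))\<^sup>2)"

section \<open>Embedding and algebra constants\<close>

definition is_embedding_const :: "'d::finite itself \<Rightarrow> real \<Rightarrow> bool" where
  "is_embedding_const _ c \<longleftrightarrow> c > 0 \<and>
     (\<forall>\<phi> \<in> (H2 :: (real^'d \<Rightarrow> real) set).
        esssup lebesgue (\<lambda>x. ereal \<bar>\<phi> x\<bar>) \<le> ereal (c * H2_norm \<phi>))"

definition is_algebra_const :: "'d::finite itself \<Rightarrow> real \<Rightarrow> bool" where
  "is_algebra_const _ c \<longleftrightarrow> c > 0 \<and>
     (\<forall>\<phi>\<^sub>1 \<in> (H2 :: (real^'d \<Rightarrow> real) set). \<forall>\<phi>\<^sub>2 \<in> H2.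
        (\<lambda>x. \<phi>\<^sub>1 x * \<phi>\<^sub>2 x) \<in> H2 \<and>
        H2_norm (\<lambda>x. \<phi>\<^sub>1 x * \<phi>\<^sub>2 x) \<le> c * H2_norm \<phi>\<^sub>1 * H2_norm \<phi>\<^sub>2)"

section \<open>The ball \<open>I\<close> and \<open>C\<^sup>1\<close> functions on it\<close>

definition I_ball :: "real \<Rightarrow> (real^'d::finite \<Rightarrow> real^'N::finite) \<Rightarrow> (real^'N) set" where
  "I_ball ce u\<^sub>0 = {z. norm z \<le> ce * (vec_H2_norm u\<^sub>0 + 1)}"

text \<open>At boundary points of the closed ball, derivatives are taken relative to the ball; they are
  unique there because the ball is convex with nonempty interior.\<close>

definition partial_on :: "(real^'N::finite) set \<Rightarrow> 'N \<Rightarrow> (real^'N \<Rightarrow> real) \<Rightarrow> real^'N \<Rightarrow> real" where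
  "partial_on S n f z = frechet_derivative f (at z within S) (axis n 1)"

definition C1_on :: "(real^'N::finite) set \<Rightarrow> (real^'N \<Rightarrow> real) \<Rightarrow> bool" where
  "C1_on S f \<longleftrightarrow> f differentiable_on S \<and> (\<forall>n. continuous_on S (partial_on S n f))"

text \<open>On the compact ball, the supremum for a continuous function is the maximum.\<close>

definition C_norm :: "(real^'N::finite) set \<Rightarrow> (real^'N \<Rightarrow> real) \<Rightarrow> real" where
  "C_norm S f = (SUP z\<in>S. \<bar>f z\<bar>)"

definition C1_norm :: "(real^'N::finite) set \<Rightarrow> (real^'N \<Rightarrow> real) \<Rightarrow> real" where
  "C1_norm S f = C_norm S f + (\<Sum>n\<in>UNIV. C_norm S (partial_on S n f))"

definition vec_C1_norm :: "(real^'N::finite) set \<Rightarrow> (real^'N \<Rightarrow> real^'N) \<Rightarrow> real" where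
  "vec_C1_norm S g = (\<Sum>m\<in>UNIV. C1_norm S (\<lambda>z. g z $ m))"

definition D_set :: "(real^'N::finite) set \<Rightarrow> real \<Rightarrow> (real^'N \<Rightarrow> real^'N) set" where
  "D_set S M = {g. (\<forall>m. C1_on S (\<lambda>z. g z $ m)) \<and> vec_C1_norm S g \<le> M}"

section \<open>The map \<open>t\<^sub>g\<close> and its fixed points\<close>

definition B_ball :: "real \<Rightarrow> (real^'d::finite \<Rightarrow> real^'N::finite) set" where
  "B_ball \<rho> = {u \<in> vec_H2. vec_H2_norm u \<le> \<rho>}"

definition t_map ::
  "('N::finite \<Rightarrow> (real^'d::finite \<Rightarrow> real) \<Rightarrow> (real^'d \<Rightarrow> real)) \<Rightarrow>
   ('N \<Rightarrow> real^'d \<Rightarrow> real) \<Rightarrow> (real^'d \<Rightarrow> real^'N) \<Rightarrow> (real^'N \<Rightarrow> real^'N) \<Rightarrow>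
   (real^'d \<Rightarrow> real^'N) \<Rightarrow> real^'d \<Rightarrow> real^'N" where
  "t_map T K u\<^sub>0 g v x =
     (\<chi> m. T m (\<lambda>y. u\<^sub>0 y $ m + v y $ m) x *
           (LINT y|lebesgue. K m (x - y) * g (u\<^sub>0 y + v y) $ m))"

definition is_fixed_point_in ::
  "(real^'d::finite \<Rightarrow> real^'N::finite) set \<Rightarrow>
   ((real^'d \<Rightarrow> real^'N) \<Rightarrow> (real^'d \<Rightarrow> real^'N)) \<Rightarrow> (real^'d \<Rightarrow> real^'N) \<Rightarrow> bool" where
  "is_fixed_point_in B t v \<longleftrightarrow> v \<in> B \<and> (AE x in lebesgue. t v x = v x)"

end

theory Submission
  imports Defs
begin

text \<open>
  Let \<open>\<delta>\<close> be the norm of \<open>u\<^sub>1 - u\<^sub>2\<close>, let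
  \<open>U\<close> be the norm of \<open>u\<^sub>0\<close> plus one, and let \<open>D\<close> be the
  \<open>C\<^sup>1\<close> norm of \<open>g\<^sub>1 - g\<^sub>2\<close>. Both solutions have norm at
  most \<open>U\<close>, so by the embedding constant they take almost all their values in the ball
  \<open>I\<close> (\<open>AE_norm_le_embedding\<close>). Subtracting the two fixed point equations
  and writing \<open>K \<star> f\<close> for a convolution, the \<open>m\<close>-th component of
  \<open>u\<^sub>1 - u\<^sub>2\<close> equals \<open>T (u\<^sub>1 - u\<^sub>2) * (K \<star>
  g\<^sub>1(u\<^sub>1)) + T u\<^sub>2 * (K \<star> (g\<^sub>1(u\<^sub>1) -
  g\<^sub>2(u\<^sub>2)))\<close>. The algebra property bounds the norms of the products.

  The convolutions are controlled by \<open>H2_norm (K \<star> f) \<le> W21_norm K * L2_norm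
  f\<close> (\<open>convolution_H2\<close>), which needs Young's inequality and the fact that the
  weak Laplacian of \<open>K \<star> f\<close> is the convolution of the Laplacian of
  \<open>K\<close> with \<open>f\<close>. The \<open>L\<^sup>2\<close> norms of the nonlinear terms
  are controlled by the mean value inequality on the convex set \<open>I\<close>
  (\<open>superposition_Lipschitz\<close>): the functions \<open>g\<^sub>1\<close> and
  \<open>g\<^sub>1 - g\<^sub>2\<close> are Lipschitz there with constants \<open>M\<close> and
  \<open>D\<close>, and they vanish at \<open>0\<close>, so \<open>g\<^sub>1(u\<^sub>1)\<close> has
  \<open>L\<^sup>2\<close> norm at most \<open>M * U\<close>, and \<open>g\<^sub>1(u\<^sub>1) -
  g\<^sub>2(u\<^sub>2)\<close>, which is \<open>(g\<^sub>1(u\<^sub>1) - g\<^sub>1(u\<^sub>2)) +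
  (g\<^sub>1 - g\<^sub>2)(u\<^sub>2)\<close>, at most \<open>M * \<delta> + D * U\<close>. Taking
  the Euclidean norm over the components \<open>m\<close> gives \<open>\<delta> \<le> c\<^sub>a * Q
  * (2 * M * U * \<delta> + D * U\<^sup>2) = \<sigma> * \<delta> + c\<^sub>a * Q * U\<^sup>2 *
  D\<close>. The smallness condition says \<open>\<sigma> * U \<le> \<rho> \<le> 1\<close>, and
  \<open>U > 1\<close> because \<open>u\<^sub>0\<close> is nontrivial. Hence \<open>\<sigma> <
  1\<close>, the term \<open>\<sigma> * \<delta>\<close> is absorbed, and the claim follows.

  All of this rests on the weak Laplacian being unique up to null sets
  (\<open>weak_laplacian_unique\<close>). The norm of \<open>H\<^sup>2\<close> is defined with an
  arbitrarily chosen weak Laplacian; without uniqueness not even the triangle inequality would be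
  available. Uniqueness is the fundamental lemma of the calculus of variations, for which smooth
  cut-off functions of boxes are built as products of functions of one variable.
\<close>

section \<open>Smooth cut-off functions of boxes\<close>

text \<open>
  With \<open>r = (t - a) * (b - t)\<close>, these are the functions \<open>q / r ^ k * exp (- c /
  r)\<close> on \<open>(a, b)\<close>. The start is \<open>exp (- c / r)\<close>; the polynomial
  \<open>q\<close> and the exponent \<open>k\<close> are there because the family that they give is
  closed under differentiation, so that a single computation of a derivative yields smoothness.
\<close>

definition bump :: "real \<Rightarrow> real \<Rightarrow> real \<Rightarrow> real poly \<Rightarrow> nat \<Rightarrow> real \<Rightarrow> real" where
  "bump c a b q k t =
     (if a < t \<and> t < b then poly q t / ((t - a) * (b - t)) ^ k * exp (- c / ((t - a) * (b - t))) else 0)"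

text \<open>
  By the quotient rule, the derivative of \<open>q / r ^ k * exp (- c / r)\<close> is this
  polynomial times \<open>exp (- c / r) / r ^ (k + 2)\<close>.
\<close>

definition bump_deriv_poly :: "real \<Rightarrow> real \<Rightarrow> real \<Rightarrow> real poly \<Rightarrow> nat \<Rightarrow> real poly" where
  "bump_deriv_poly c a b q k =
     (let r = [:- (a * b), a + b, -1:] in
      pderiv q * r\<^sup>2 - of_nat k * q * pderiv r * r + smult c (q * pderiv r))"

text \<open>
  The exponential beats every power: compare \<open>exp (c / s)\<close> with the term of degree
  \<open>k + 2\<close> of its power series. The two extra powers leave the factor
  \<open>s\<^sup>2\<close>, which is what gives a vanishing derivative at the end points of the
  support.
\<close>

lemma power_times_exp_le:
  fixes c s :: real
  assumes "c > 0" "s > 0"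
  shows "exp (- c / s) / s ^ k \<le> fact (k + 2) / c ^ (k + 2) * s\<^sup>2"
proof -
  let ?n = "k + 2"
  have "(\<Sum>i\<in>{?n}. (c / s) ^ i /\<^sub>R fact i) \<le> (\<Sum>i. (c / s) ^ i /\<^sub>R fact i)"
    using assms by (intro sum_le_suminf summable_exp_generic) auto
  then have "(c / s) ^ ?n / fact ?n \<le> exp (c / s)"
    by (simp add: exp_def divide_inverse mult.commute)
  then have "exp (- (c / s)) \<le> fact ?n / (c / s) ^ ?n"
    using le_imp_inverse_le[of "(c / s) ^ ?n / fact ?n" "exp (c / s)"] assms
    by (simp only: exp_minus inverse_divide zero_less_divide_iff zero_less_power fact_gt_zero) simp
  then have "exp (- c / s) / s ^ k \<le> fact ?n / (c / s) ^ ?n / s ^ k"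
    using assms by (intro divide_right_mono) auto
  also have "\<dots> = fact ?n / c ^ ?n * s\<^sup>2"
    using assms by (simp add: power_divide power_add field_simps power2_eq_square)
  finally show ?thesis .
qed

text \<open>
  Seen from a point \<open>t\<close> outside \<open>(a, b)\<close>, each \<open>x\<close> in
  \<open>(a, b)\<close> has one of the factors of \<open>r = (x - a) * (b - x)\<close> bounded by
  \<open>\<bar>x - t\<bar>\<close> and the other one by \<open>b - a\<close>. A bound quadratic in
  \<open>r\<close> is therefore quadratic in \<open>x - t\<close>.
\<close>

lemma bump_quadratic_bound:
  assumes c: "c > 0"
  obtains C where "C \<ge> 0"
    "\<And>t x. \<not> (a < t \<and> t < b) \<Longrightarrow> \<bar>bump c a b q k x\<bar> \<le> C * (x - t)\<^sup>2"
proof -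
  have "compact (poly q ` {a..b})"
    by (intro compact_continuous_image) (auto intro!: continuous_intros)
  then obtain B where B: "\<And>x. x \<in> {a..b} \<Longrightarrow> \<bar>poly q x\<bar> \<le> B"
    by (force dest!: compact_imp_bounded simp: bounded_iff)
  define F where "F = fact (k + 2) / c ^ (k + 2)"
  have F: "F \<ge> 0" using c by (simp add: F_def)
  define C where "C = \<bar>B\<bar> * F * (b - a)\<^sup>2"
  show ?thesis
  proof
    show "C \<ge> 0" using F by (simp add: C_def)
    fix t x assume t: "\<not> (a < t \<and> t < b)"
    show "\<bar>bump c a b q k x\<bar> \<le> C * (x - t)\<^sup>2"
    proof (cases "a < x \<and> x < b")
      case True
      define r where "r = (x - a) * (b - x)"
      have r: "r > 0" using True by (simp add: r_def)
      have "r \<le> (b - a) * \<bar>x - t\<bar>"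
      proof (cases "t \<le> a")
        case ta: True
        have "(b - x) * (x - a) \<le> (b - a) * \<bar>x - t\<bar>"
          using True ta by (intro mult_mono) auto
        then show ?thesis by (simp add: r_def mult.commute)
      next
        case False
        then have "(x - a) * (b - x) \<le> (b - a) * \<bar>x - t\<bar>"
          using True t by (intro mult_mono) auto
        then show ?thesis by (simp add: r_def)
      qed
      then have r2: "r\<^sup>2 \<le> (b - a)\<^sup>2 * (x - t)\<^sup>2"
        using r by (metis power_mono less_imp_le power_mult_distrib power2_abs)
      have "\<bar>bump c a b q k x\<bar> = \<bar>poly q x\<bar> * (exp (- c / r) / r ^ k)"
        using True r by (simp add: bump_def r_def[symmetric] abs_mult)
      also have "\<dots> \<le> \<bar>B\<bar> * (F * r\<^sup>2)"
        using power_times_exp_le[OF c r, of k] B[of x] True r unfolding F_def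
        by (intro mult_mono) auto
      also have "\<dots> \<le> \<bar>B\<bar> * (F * ((b - a)\<^sup>2 * (x - t)\<^sup>2))"
        using F r2 by (intro mult_left_mono) auto
      finally show ?thesis by (simp add: C_def algebra_simps)
    next
      case xout: False
      then have "bump c a b q k x = 0" unfolding bump_def by (rule if_not_P)
      then show ?thesis using F by (simp add: C_def)
    qed
  qed
qed

lemma bump_has_derivative:
  assumes c: "c > 0"
  shows "(bump c a b q k has_real_derivative bump c a b (bump_deriv_poly c a b q k) (k + 2) t) (at t)"
proof (cases "a < t \<and> t < b")
  case True
  define r where "r = [:- (a * b), a + b, -1::real:]"
  have rp: "(x - a) * (b - x) = poly r x" for x
    by (simp add: r_def algebra_simps)
  have r0: "poly r t > 0" using True by (simp flip: rp)
  have "((\<lambda>x. poly q x / poly r x ^ k * exp (- c / poly r x)) has_real_derivative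
      poly (bump_deriv_poly c a b q k) t / poly r t ^ (k + 2) * exp (- c / poly r t)) (at t)"
  proof -
    define R P P' where "R = poly r t" and "P = R ^ k" and "P' = R ^ (k - 1)"
    have nz: "R \<noteq> 0" "P \<noteq> 0" using r0 by (simp_all add: R_def P_def)
    \<comment> \<open>At \<open>k = 0\<close> the power \<open>k - 1\<close> is truncated to \<open>0\<close>; the factor \<open>real k\<close> makes \<open>kP\<close> true there too.\<close>
    have kP: "real k * P' = real k * P / R"
      using nz(1) by (cases k) (simp_all add: P_def P'_def)
    have "((\<lambda>x. poly q x / poly r x ^ k * exp (- c / poly r x)) has_real_derivative
      ((poly (pderiv q) t * P - poly q t * ((real k * P') * poly (pderiv r) t)) / (P * P)) * exp (- c / R) +
      (exp (- c / R) * ((c * poly (pderiv r) t) / (R * R))) * (poly q t / P)) (at t)"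
      by (rule derivative_eq_intros refl | use nz in \<open>simp add: R_def P_def P'_def\<close>)+
    also have "((poly (pderiv q) t * P - poly q t * ((real k * P') * poly (pderiv r) t)) / (P * P)) * exp (- c / R) +
      (exp (- c / R) * ((c * poly (pderiv r) t) / (R * R))) * (poly q t / P) =
      poly (bump_deriv_poly c a b q k) t / poly r t ^ (k + 2) * exp (- c / poly r t)"
      unfolding kP power_add R_def[symmetric] P_def[symmetric] bump_deriv_poly_def Let_def r_def[symmetric]
      using nz by (simp add: field_simps power2_eq_square R_def[symmetric])
    finally show ?thesis .
  qed
  moreover have bump_eq: "bump c a b q' k' x = poly q' x / poly r x ^ k' * exp (- c / poly r x)"
    if "x \<in> {a<..<b}" for x q' k'
    using that unfolding bump_def rp by simp
  ultimately have "((\<lambda>x. poly q x / poly r x ^ k * exp (- c / poly r x)) has_real_derivative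
      bump c a b (bump_deriv_poly c a b q k) (k + 2) t) (at t)"
    using True by (subst bump_eq) simp
  then show ?thesis
    by (rule has_field_derivative_transform_within_open[where S = "{a<..<b}"])
      (use True bump_eq in \<open>simp_all only: open_greaterThanLessThan greaterThanLessThan_iff simp_thms\<close>)
next
  case False
  obtain C where C: "C \<ge> 0" "\<And>x. \<bar>bump c a b q k x\<bar> \<le> C * (x - t)\<^sup>2"
    using bump_quadratic_bound[OF c, of a b q k] False by metis
  have "(\<lambda>x. (bump c a b q k x - bump c a b q k t) / (x - t)) \<midarrow>t\<rightarrow> 0"
  proof (rule Lim_null_comparison)
    show "\<forall>\<^sub>F x in at t. norm ((bump c a b q k x - bump c a b q k t) / (x - t)) \<le> C * \<bar>x - t\<bar>"
    proof (intro always_eventually allI)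
      fix x
      have "bump c a b q k t = 0" using False by (auto simp: bump_def)
      then show "norm ((bump c a b q k x - bump c a b q k t) / (x - t)) \<le> C * \<bar>x - t\<bar>"
        using C(2)[of x] C(1)
        by (cases "x = t") (auto simp: abs_divide divide_le_eq power2_eq_square algebra_simps simp flip: abs_mult)
    qed
    show "((\<lambda>x. C * \<bar>x - t\<bar>) \<longlongrightarrow> 0) (at t)"
      by (auto intro!: tendsto_eq_intros)
  qed
  moreover have "bump c a b (bump_deriv_poly c a b q k) (k + 2) t = 0"
    using False by (auto simp: bump_def)
  ultimately show ?thesis
    by (simp add: has_field_derivative_iff)
qed

definition bump_product ::
  "real \<Rightarrow> real^'n::finite \<Rightarrow> real^'n \<Rightarrow> ('n \<Rightarrow> real poly) \<Rightarrow> ('n \<Rightarrow> nat) \<Rightarrow> real^'n \<Rightarrow> real" where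
  "bump_product c a b q k x = (\<Prod>i\<in>UNIV. bump c (a $ i) (b $ i) (q i) (k i) (x $ i))"

text \<open>
  By the product rule, each summand of the derivative is again a product of bumps: the factor in one
  coordinate is replaced by its derivative.
\<close>

lemma bump_product_has_derivative:
  assumes c: "c > 0"
  shows "(bump_product c a b q k has_derivative
     (\<lambda>h. \<Sum>i\<in>UNIV. h $ i * bump_product c a b
        (q(i := bump_deriv_poly c (a $ i) (b $ i) (q i) (k i))) (k(i := k i + 2)) x)) (at x)"
proof -
  have 1: "((\<lambda>x. bump c (a $ i) (b $ i) (q i) (k i) (x $ i)) has_derivative
     (\<lambda>h. h $ i * bump c (a $ i) (b $ i) (bump_deriv_poly c (a $ i) (b $ i) (q i) (k i)) (k i + 2) (x $ i))) (at x)"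
    for i
    using has_derivative_compose[OF bounded_linear_imp_has_derivative[OF bounded_linear_vec_nth]
       bump_has_derivative[OF c, unfolded has_field_derivative_def]]
    by (simp add: mult.commute[of "_ $ _"])
  have 2: "bump_product c a b (q(i := p)) (k(i := l)) x =
      bump c (a $ i) (b $ i) p l (x $ i) * (\<Prod>j\<in>UNIV - {i}. bump c (a $ j) (b $ j) (q j) (k j) (x $ j))"
    for i p l
    unfolding bump_product_def
    by (subst prod.remove[of _ i]) auto
  have 3: "bump_product c a b q k = (\<lambda>x. \<Prod>i\<in>UNIV. bump c (a $ i) (b $ i) (q i) (k i) (x $ i))"
    by (simp add: bump_product_def fun_eq_iff)
  show ?thesis
    unfolding 3 2
    by (rule has_derivative_eq_rhs[OF has_derivative_prod[OF 1]]) (simp add: mult.assoc)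
qed

lemma partial_bump_product:
  assumes c: "c > 0"
  shows "partial i (bump_product c a b q k) =
     bump_product c a b (q(i := bump_deriv_poly c (a $ i) (b $ i) (q i) (k i))) (k(i := k i + 2))"
proof
  fix x
  show "partial i (bump_product c a b q k) x =
     bump_product c a b (q(i := bump_deriv_poly c (a $ i) (b $ i) (q i) (k i))) (k(i := k i + 2)) x"
    unfolding partial_def frechet_derivative_at[OF bump_product_has_derivative[OF c], symmetric]
    by (simp add: axis_def if_distrib if_distribR sum.delta cong: if_cong)
qed

text \<open>
  All iterated partial derivatives stay in the family of products of bumps, and each member of the
  family is differentiable.
\<close>

lemma smooth_bump_product:
  assumes c: "c > 0"
  shows "smooth (bump_product c a b q k)"
proof -
  have "\<exists>q' k'. foldr partial is (bump_product c a b q k) = bump_product c a b q' k'" for "is"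
    by (induction "is") (use partial_bump_product[OF c] in \<open>force+\<close>)
  moreover have "bump_product c a b q' k' differentiable_on UNIV" for q' k'
    unfolding differentiable_on_def
    by (intro ballI differentiableI[OF bump_product_has_derivative[OF c]])
  ultimately show ?thesis
    by (metis smooth_def)
qed

lemma bump_product_eq_0: "x \<notin> box a b \<Longrightarrow> bump_product c a b q k x = 0"
  by (auto simp: bump_product_def mem_box_cart bump_def)

lemma test_function_bump_product:
  assumes c: "c > 0"
  shows "test_function (bump_product c a b q k)"
proof -
  have "{x. bump_product c a b q k x \<noteq> 0} \<subseteq> cbox a b"
    using bump_product_eq_0 box_subset_cbox by blast
  then have "closure {x. bump_product c a b q k x \<noteq> 0} \<subseteq> cbox a b"
    by (rule closure_minimal) (rule closed_cbox)
  then have "compact (closure {x. bump_product c a b q k x \<noteq> 0})"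
    by (meson bounded_cbox bounded_subset closed_closure compact_eq_bounded_closed)
  then show ?thesis using smooth_bump_product[OF c] by (simp add: test_function_def)
qed

text \<open>
  As the parameter \<open>c = 1 / (n + 1)\<close> tends to \<open>0\<close>, the factor \<open>exp
  (- c / r)\<close> tends to \<open>1\<close> inside the box, while it stays \<open>0\<close>
  outside. So these test functions converge boundedly to the indicator of the open box.
\<close>

definition box_cutoff :: "real^'n::finite \<Rightarrow> real^'n \<Rightarrow> nat \<Rightarrow> real^'n \<Rightarrow> real" where
  "box_cutoff a b n = bump_product (1 / real (Suc n)) a b (\<lambda>_. 1) (\<lambda>_. 0)"

lemma test_function_box_cutoff: "test_function (box_cutoff a b n)"
  unfolding box_cutoff_def by (rule test_function_bump_product) simp

lemma box_cutoff_bounds: "\<bar>box_cutoff a b n x\<bar> \<le> indicator (cbox a b) x"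
proof (cases "x \<in> box a b")
  case True
  have "\<bar>bump (1 / real (Suc n)) (a $ i) (b $ i) 1 0 (x $ i)\<bar> \<le> 1" for i
    using True by (auto simp: bump_def mem_box_cart intro!: mult_nonneg_nonneg less_imp_le)
  then have "(\<Prod>i\<in>UNIV. \<bar>bump (1 / real (Suc n)) (a $ i) (b $ i) 1 0 (x $ i)\<bar>) \<le> 1"
    by (intro prod_le_1) auto
  then show ?thesis
    using True box_subset_cbox[of a b] by (auto simp: box_cutoff_def bump_product_def abs_prod)
next
  case False
  then show ?thesis by (simp add: box_cutoff_def bump_product_eq_0)
qed

lemma box_cutoff_tendsto: "(\<lambda>n. box_cutoff a b n x) \<longlonglongrightarrow> indicator (box a b) x"
proof (cases "x \<in> box a b")
  case True
  have "(\<lambda>n. bump (1 / real (Suc n)) (a $ i) (b $ i) 1 0 (x $ i)) \<longlonglongrightarrow> 1" for i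
  proof -
    define r where "r = (x $ i - a $ i) * (b $ i - x $ i)"
    have r: "r \<noteq> 0" "a $ i < x $ i" "x $ i < b $ i"
      using True by (auto simp: r_def mem_box_cart dest: spec[of _ i])
    have "(\<lambda>n. exp (- (1 / real (Suc n)) / r)) \<longlonglongrightarrow> exp (- 0 / r)"
      by (intro tendsto_exp tendsto_divide tendsto_minus tendsto_const r(1) LIMSEQ_Suc[OF lim_1_over_n])
    then show ?thesis unfolding bump_def r_def[symmetric] using r by simp
  qed
  then have "(\<lambda>n. \<Prod>i\<in>UNIV. bump (1 / real (Suc n)) (a $ i) (b $ i) 1 0 (x $ i)) \<longlonglongrightarrow> (\<Prod>i\<in>(UNIV::'a set). 1)"
    by (intro tendsto_prod)
  then show ?thesis using True by (simp add: box_cutoff_def bump_product_def[abs_def])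
next
  case False
  then show ?thesis by (simp add: box_cutoff_def bump_product_eq_0)
qed

section \<open>Uniqueness of the weak Laplacian\<close>

lemma lebesgue_borel_representative:
  fixes f :: "'a::euclidean_space \<Rightarrow> real"
  assumes "f \<in> borel_measurable lebesgue"
  obtains g where "g \<in> borel_measurable borel" "AE x in lebesgue. f x = g x"
proof -
  obtain g where "g \<in> borel_measurable lborel" "AE x in lborel. f x = g x"
    using completion_ex_borel_measurable_real[OF assms] by blast
  then show ?thesis using that by (simp add: AE_completion)
qed

text \<open>
  Completeness of the Lebesgue measure: every subset of a null set is measurable.
\<close>

lemma borel_measurable_lebesgue_cong_AE:
  fixes f g :: "'a::euclidean_space \<Rightarrow> 'b::topological_space"
  assumes "AE x in lebesgue. f x = g x" "g \<in> borel_measurable lebesgue"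
  shows "f \<in> borel_measurable lebesgue"
proof (rule measurableI)
  fix A :: "'b set" assume A: "A \<in> sets borel"
  obtain N where N: "{x \<in> space lebesgue. f x \<noteq> g x} \<subseteq> N" "N \<in> null_sets lebesgue"
    using assms(1) unfolding eventually_ae_filter by auto
  have "f -` A \<inter> space lebesgue = (g -` A \<inter> space lebesgue - N) \<union> (f -` A \<inter> N)"
    using N(1) by auto
  moreover have "f -` A \<inter> N \<in> sets lebesgue"
    using N(2) null_sets_completion_subset[of "f -` A \<inter> N" N lborel] by auto
  ultimately show "f -` A \<inter> space lebesgue \<in> sets lebesgue"
    using measurable_sets[OF assms(2) A] null_setsD2[OF N(2)] by (metis sets.Diff sets.Un)
qed auto

lemma integral_lebesgue_cong_AE:
  fixes f g :: "'a::euclidean_space \<Rightarrow> real"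
  assumes "AE x in lebesgue. f x = g x"
  shows "integral\<^sup>L lebesgue f = integral\<^sup>L lebesgue g"
proof (cases "f \<in> borel_measurable lebesgue")
  case True
  have "g \<in> borel_measurable lebesgue"
    by (rule borel_measurable_lebesgue_cong_AE[OF _ True]) (use assms in auto)
  then show ?thesis using True assms by (intro integral_cong_AE)
next
  case False
  then have "g \<notin> borel_measurable lebesgue"
    using borel_measurable_lebesgue_cong_AE[OF assms] by auto
  then show ?thesis using False
    by (metis borel_measurable_integrable not_integrable_integral_eq)
qed

lemma integrable_lebesgue_cong_AE:
  fixes f g :: "'a::euclidean_space \<Rightarrow> real"
  assumes "AE x in lebesgue. f x = g x" "integrable lebesgue g"
  shows "integrable lebesgue f"
proof (rule integrable_cong_AE_imp[OF assms(2)])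
  show "f \<in> borel_measurable lebesgue"
    using assms by (intro borel_measurable_lebesgue_cong_AE[OF assms(1)]) auto
  show "AE x in lebesgue. g x = f x" using assms(1) by eventually_elim simp
qed

text \<open>
  The positive and the negative part of \<open>f\<close> are densities of two measures that agree on
  open boxes. Open boxes form a generator of the Borel sets that is stable under intersection, so
  the two measures are equal, and hence so are their densities.
\<close>

lemma AE_zero_if_box_integrals_zero:
  fixes f :: "'a::euclidean_space \<Rightarrow> real"
  assumes meas: "f \<in> borel_measurable lebesgue"
    and int: "\<And>a b. integrable lebesgue (\<lambda>x. f x * indicator (box a b) x)"
    and zero: "\<And>a b. (LINT x|lebesgue. f x * indicator (box a b) x) = 0"
  shows "AE x in lebesgue. f x = 0"
proof -
  obtain g where g[measurable]: "g \<in> borel_measurable borel" and fg: "AE x in lebesgue. f x = g x"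
    using lebesgue_borel_representative[OF meas] .
  let ?P = "density lborel (\<lambda>x. ennreal (g x))" and ?N = "density lborel (\<lambda>x. ennreal (- g x))"
  have gi: "integrable lborel (\<lambda>x. g x * indicator (box a b) x)" for a b
  proof -
    have "integrable lebesgue (\<lambda>x. g x * indicator (box a b) x)"
      using fg by (intro integrable_lebesgue_cong_AE[OF _ int[of a b]]) auto
    then show ?thesis by (subst (asm) integrable_completion) auto
  qed
  have g0: "(LINT x|lborel. g x * indicator (box a b) x) = 0" for a b
  proof -
    have "(LINT x|lebesgue. g x * indicator (box a b) x) = (LINT x|lebesgue. f x * indicator (box a b) x)"
      using fg by (intro integral_lebesgue_cong_AE) auto
    then show ?thesis using zero[of a b] by (subst (asm) integral_completion) auto
  qed
  have ind: "ennreal (h x) * indicator A x = ennreal (h x * indicator A x)"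
    for h :: "'a \<Rightarrow> real" and A x
    by (auto simp: indicator_def)
  have eq: "emeasure ?P (box a b) = emeasure ?N (box a b)"
    and fin: "emeasure ?P (box a b) \<noteq> \<infinity>" for a b
  proof -
    let ?h = "\<lambda>x. g x * indicator (box a b) x"
    have P: "emeasure ?P (box a b) = (\<integral>\<^sup>+x. ennreal (?h x) \<partial>lborel)"
      by (subst emeasure_density) (auto simp: ind)
    have N: "emeasure ?N (box a b) = (\<integral>\<^sup>+x. ennreal (- ?h x) \<partial>lborel)"
      using ind[of "\<lambda>x. - g x"] by (subst emeasure_density) auto
    have f1: "(\<integral>\<^sup>+x. ennreal (?h x) \<partial>lborel) \<noteq> \<infinity>" "(\<integral>\<^sup>+x. ennreal (- ?h x) \<partial>lborel) \<noteq> \<infinity>"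
      using gi[of a b] unfolding real_integrable_def by auto
    moreover have "enn2real (\<integral>\<^sup>+x. ennreal (?h x) \<partial>lborel) = enn2real (\<integral>\<^sup>+x. ennreal (- ?h x) \<partial>lborel)"
      using real_lebesgue_integral_def[OF gi[of a b]] g0[of a b] by simp
    moreover have "p = q" if "p \<noteq> \<infinity>" "q \<noteq> \<infinity>" "enn2real p = enn2real q" for p q
      using that by (cases p; cases q) auto
    ultimately show "emeasure ?P (box a b) = emeasure ?N (box a b)"
      unfolding P N by blast
    show "emeasure ?P (box a b) \<noteq> \<infinity>" unfolding P by (rule f1(1))
  qed
  have "?P = ?N"
  proof (rule measure_eqI_generator_eq)
    let ?E = "range (\<lambda>(a, b). box a b::'a set)"
    show "Int_stable ?E" by (auto simp: Int_stable_def box_Int_box)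
    show "?E \<subseteq> Pow UNIV" "sets ?P = sigma_sets UNIV ?E" "sets ?N = sigma_sets UNIV ?E"
      by (simp_all add: borel_eq_box)
    let ?A = "\<lambda>n::nat. box (- (real n *\<^sub>R One)) (real n *\<^sub>R One) :: 'a set"
    show "range ?A \<subseteq> ?E" "(\<Union>i. ?A i) = UNIV"
      unfolding UN_box_eq_UNIV by auto
    show "emeasure ?P (?A i) \<noteq> \<infinity>" for i by (rule fin)
    show "emeasure ?P X = emeasure ?N X" if "X \<in> ?E" for X
      using that eq by auto
  qed
  then have "AE x in lborel. ennreal (g x) = ennreal (- g x)"
    by (intro sigma_finite_measure.density_unique[OF sigma_finite_lborel]) auto
  then have "AE x in lborel. g x = 0"
  proof eventually_elim
    case (elim x)
    then show "g x = 0"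
      by (cases "g x \<le> 0") (auto simp: ennreal_neg)
  qed
  then have "AE x in lebesgue. g x = 0" by (rule AE_completion)
  with fg show ?thesis by eventually_elim simp
qed

lemma locally_integrable_measurable:
  assumes "locally_integrable f"
  shows "f \<in> borel_measurable lebesgue"
proof (rule borel_measurable_LIMSEQ_real)
  show "(\<lambda>n. indicator (cball 0 (real n)) x *\<^sub>R f x) \<longlonglongrightarrow> f x" for x
  proof (rule tendsto_eventually)
    obtain m :: nat where "norm x \<le> real m" using real_arch_simple by blast
    then show "\<forall>\<^sub>F n in sequentially. indicator (cball 0 (real n)) x *\<^sub>R f x = f x"
      by (intro eventually_sequentiallyI[of m]) (auto simp: indicator_def)
  qed
  show "(\<lambda>x. indicator (cball 0 (real n)) x *\<^sub>R f x) \<in> borel_measurable lebesgue" for n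
    using assms unfolding locally_integrable_def set_integrable_def
    by (intro borel_measurable_integrable) simp
qed

text \<open>
  The class of functions against which a locally integrable function can be integrated. It contains
  the test functions and their Laplacians.
\<close>

definition cont_compact_support :: "(real^'n::finite \<Rightarrow> real) \<Rightarrow> bool" where
  "cont_compact_support \<psi> \<longleftrightarrow> continuous_on UNIV \<psi> \<and> (\<exists>C. compact C \<and> (\<forall>x. x \<notin> C \<longrightarrow> \<psi> x = 0))"

lemma cont_compact_support_bounded:
  assumes "cont_compact_support \<psi>"
  obtains C B where "compact C" "\<And>x. x \<notin> C \<Longrightarrow> \<psi> x = 0" "\<And>x. \<bar>\<psi> x\<bar> \<le> B" "B \<ge> 0"
proof -
  obtain C where C: "compact C" "\<And>x. x \<notin> C \<Longrightarrow> \<psi> x = 0" and cont: "continuous_on UNIV \<psi>"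
    using assms by (auto simp: cont_compact_support_def)
  have "compact (\<psi> ` C)"
    using C(1) cont by (meson compact_continuous_image continuous_on_subset subset_UNIV)
  then obtain B where B: "\<And>x. x \<in> C \<Longrightarrow> \<bar>\<psi> x\<bar> \<le> B"
    by (force dest!: compact_imp_bounded simp: bounded_iff)
  have "\<bar>\<psi> x\<bar> \<le> \<bar>B\<bar>" for x
    using B[of x] C(2)[of x] by (cases "x \<in> C") auto
  then show ?thesis using that C by (meson abs_ge_zero)
qed

lemma cont_compact_support_borel: "cont_compact_support \<psi> \<Longrightarrow> \<psi> \<in> borel_measurable borel"
  unfolding cont_compact_support_def by (blast intro: borel_measurable_continuous_onI)

lemma cont_compact_support_translate:
  assumes "cont_compact_support \<psi>"
  shows "cont_compact_support (\<lambda>x. \<psi> (x + a))"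
proof -
  obtain C where C: "compact C" "\<And>x. x \<notin> C \<Longrightarrow> \<psi> x = 0" and cont: "continuous_on UNIV \<psi>"
    using assms by (auto simp: cont_compact_support_def)
  have "continuous_on UNIV (\<lambda>x. \<psi> (x + a))"
    by (rule continuous_on_compose2[OF cont]) (auto intro!: continuous_intros)
  moreover have "compact ((\<lambda>x. x - a) ` C)"
    using C(1) by (intro compact_continuous_image continuous_intros)
  moreover have "\<psi> (x + a) = 0" if "x \<notin> (\<lambda>x. x - a) ` C" for x
    using that C(2)[of "x + a"] by force
  ultimately show ?thesis unfolding cont_compact_support_def by blast
qed

lemma integrable_times_cont_compact_support:
  assumes f: "locally_integrable f" and \<psi>: "cont_compact_support \<psi>"
  shows "integrable lebesgue (\<lambda>x. f x * \<psi> x)"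
proof -
  obtain C B where C: "compact C" "\<And>x. x \<notin> C \<Longrightarrow> \<psi> x = 0" "\<And>x. \<bar>\<psi> x\<bar> \<le> B" "B \<ge> 0"
    by (rule cont_compact_support_bounded[OF \<psi>]) (rule that)
  have "integrable lebesgue (\<lambda>x. B * (indicator C x *\<^sub>R f x))"
    using f C(1) unfolding locally_integrable_def set_integrable_def by (intro integrable_mult_right) auto
  then show ?thesis
  proof (rule Bochner_Integration.integrable_bound)
    show "(\<lambda>x. f x * \<psi> x) \<in> borel_measurable lebesgue"
      using locally_integrable_measurable[OF f] cont_compact_support_borel[OF \<psi>]
      by (intro borel_measurable_times) (auto intro: measurable_completion)
    show "AE x in lebesgue. norm (f x * \<psi> x) \<le> norm (B * (indicator C x *\<^sub>R f x))"
    proof (intro always_eventually allI)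
      fix x show "norm (f x * \<psi> x) \<le> norm (B * (indicator C x *\<^sub>R f x))"
        using C(2)[of x] mult_left_mono[OF C(3)[of x], of "\<bar>f x\<bar>"] C(4)
        by (cases "x \<in> C") (auto simp: abs_mult mult.commute)
    qed
  qed
qed

lemma smooth_imp_differentiable: "smooth f \<Longrightarrow> f differentiable (at x)"
  unfolding smooth_def by (drule spec[of _ "[]"]) (simp add: differentiable_on_def)

lemma smooth_partial: "smooth f \<Longrightarrow> smooth (partial i f)"
  unfolding smooth_def
proof
  fix js assume "\<forall>is. foldr partial is f differentiable_on UNIV"
  then have "foldr partial (js @ [i]) f differentiable_on UNIV" by blast
  then show "foldr partial js (partial i f) differentiable_on UNIV" by simp
qed

lemma partial_translate:
  assumes "f differentiable (at (x + a))"
  shows "partial i (\<lambda>x. f (x + a)) x = partial i f (x + a)"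
proof -
  have "(f has_derivative frechet_derivative f (at (x + a))) (at (x + a))"
    using assms by (simp add: frechet_derivative_works)
  moreover have "((\<lambda>x. x + a) has_derivative (\<lambda>h. h)) (at x)"
    by (rule derivative_eq_intros refl)+ simp
  ultimately have "((\<lambda>x. f (x + a)) has_derivative frechet_derivative f (at (x + a))) (at x)"
    using has_derivative_compose[of "\<lambda>x. x + a" "\<lambda>h. h" x UNIV f] by simp
  then have "frechet_derivative f (at (x + a)) = frechet_derivative (\<lambda>x. f (x + a)) (at x)"
    by (rule frechet_derivative_at)
  then show ?thesis by (simp add: partial_def)
qed

lemma smooth_translate:
  assumes "smooth f"
  shows "smooth (\<lambda>x. f (x + a))"
proof -
  have d: "foldr partial is f differentiable (at x)" for "is" x
    using assms by (auto simp: smooth_def differentiable_on_def)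
  have eq: "foldr partial is (\<lambda>x. f (x + a)) = (\<lambda>x. foldr partial is f (x + a))" for "is"
  proof (induction "is")
    case (Cons i "is")
    have "foldr partial (i # is) (\<lambda>x. f (x + a)) = partial i (\<lambda>x. foldr partial is f (x + a))"
      by (simp add: Cons.IH)
    also have "\<dots> = (\<lambda>x. foldr partial (i # is) f (x + a))"
      using partial_translate[OF d] by (simp add: fun_eq_iff)
    finally show ?case .
  qed simp
  have "(\<lambda>x. foldr partial is f (x + a)) differentiable (at x)" for "is" x
    using differentiable_compose[of "foldr partial is f" "\<lambda>x. x + a" x UNIV] d by simp
  then show ?thesis
    unfolding smooth_def eq by (simp add: differentiable_on_def)
qed

text \<open>
  Off the closed support, \<open>f\<close> vanishes on a neighbourhood.
\<close>

lemma partial_support: "{x. partial i f x \<noteq> 0} \<subseteq> closure {x. f x \<noteq> 0}"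
proof
  fix x assume x: "x \<in> {x. partial i f x \<noteq> 0}"
  show "x \<in> closure {x. f x \<noteq> 0}"
  proof (rule ccontr)
    assume nx: "x \<notin> closure {x. f x \<noteq> 0}"
    have "(f has_derivative (\<lambda>h. 0)) (at x)"
    proof (rule has_derivative_transform_within_open)
      show "((\<lambda>x. 0) has_derivative (\<lambda>h. 0)) (at x)" by simp
      show "open (- closure {x. f x \<noteq> 0})" by auto
      show "x \<in> - closure {x. f x \<noteq> 0}" using nx by simp
      show "0 = f y" if "y \<in> - closure {x. f x \<noteq> 0}" for y
        using that closure_subset[of "{x. f x \<noteq> 0}"] by auto
    qed
    then have "partial i f x = 0"
      unfolding partial_def by (metis frechet_derivative_at)
    then show False using x by simp
  qed
qed

lemma test_function_partial: "test_function \<eta> \<Longrightarrow> test_function (partial i \<eta>)"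
  unfolding test_function_def
proof (elim conjE, intro conjI)
  assume "smooth \<eta>" then show "smooth (partial i \<eta>)" by (rule smooth_partial)
  assume "compact (closure {x. \<eta> x \<noteq> 0})"
  then have "compact (closure {x. \<eta> x \<noteq> 0} \<inter> closure {x. partial i \<eta> x \<noteq> 0})"
    by (rule compact_Int_closed) (rule closed_closure)
  moreover have "closure {x. partial i \<eta> x \<noteq> 0} \<subseteq> closure {x. \<eta> x \<noteq> 0}"
    by (rule closure_minimal[OF partial_support closed_closure])
  ultimately show "compact (closure {x. partial i \<eta> x \<noteq> 0})"
    by (simp add: inf.absorb2)
qed


lemma test_function_cont_compact_support:
  assumes "test_function \<eta>"
  shows "cont_compact_support \<eta>"
proof -
  have "continuous_on UNIV \<eta>"
    using assms unfolding test_function_def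
    by (auto intro!: continuous_at_imp_continuous_on differentiable_imp_continuous_within
        smooth_imp_differentiable)
  moreover have "compact (closure {x. \<eta> x \<noteq> 0})" using assms by (simp add: test_function_def)
  moreover have "\<eta> x = 0" if "x \<notin> closure {x. \<eta> x \<noteq> 0}" for x
    using that closure_subset[of "{x. \<eta> x \<noteq> 0}"] by auto
  ultimately show ?thesis unfolding cont_compact_support_def by blast
qed

lemma test_function_translate:
  assumes "test_function \<eta>"
  shows "test_function (\<lambda>x. \<eta> (x + a))"
proof -
  have eq: "{x. \<eta> (x + a) \<noteq> 0} = (+) (- a) ` {x. \<eta> x \<noteq> 0}"
    by (force simp: image_iff)
  have "compact ((+) (- a) ` closure {x. \<eta> x \<noteq> 0})"
    using assms by (intro compact_translation) (simp add: test_function_def)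
  then have "compact (closure {x. \<eta> (x + a) \<noteq> 0})"
    unfolding eq closure_translation .
  then show ?thesis
    using assms smooth_translate[of \<eta> a] unfolding test_function_def by blast
qed

lemma classical_laplacian_translate:
  assumes "test_function \<eta>"
  shows "classical_laplacian (\<lambda>x. \<eta> (x + a)) x = classical_laplacian \<eta> (x + a)"
proof -
  have s: "smooth \<eta>" using assms by (simp add: test_function_def)
  have "partial i (\<lambda>x. \<eta> (x + a)) = (\<lambda>x. partial i \<eta> (x + a))" for i
    using partial_translate[OF smooth_imp_differentiable[OF s]] by blast
  then show ?thesis
    by (simp add: classical_laplacian_def partial_translate[OF smooth_imp_differentiable[OF smooth_partial[OF s]]])
qed

lemma cont_compact_support_add:
  assumes "cont_compact_support f" "cont_compact_support g"
  shows "cont_compact_support (\<lambda>x. f x + g x)"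
proof -
  obtain C D where "compact C" "\<And>x. x \<notin> C \<Longrightarrow> f x = 0" "compact D" "\<And>x. x \<notin> D \<Longrightarrow> g x = 0"
    using assms by (auto simp: cont_compact_support_def)
  then have "compact (C \<union> D)" "\<And>x. x \<notin> C \<union> D \<Longrightarrow> f x + g x = 0" by auto
  moreover have "continuous_on UNIV (\<lambda>x. f x + g x)"
    using assms by (auto simp: cont_compact_support_def intro!: continuous_intros)
  ultimately show ?thesis unfolding cont_compact_support_def by blast
qed

lemma cont_compact_support_laplacian:
  assumes "test_function \<eta>"
  shows "cont_compact_support (classical_laplacian \<eta>)"
proof -
  have "cont_compact_support (\<lambda>x. \<Sum>i\<in>A. partial i (partial i \<eta>) x)" if "finite A" for A :: "'a set"
    using that
  proof induction
    case empty
    show ?case by (auto simp: cont_compact_support_def)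
  next
    case (insert i A)
    then show ?case
      using cont_compact_support_add[OF test_function_cont_compact_support[OF
          test_function_partial[OF test_function_partial[OF assms]]] insert.IH] by simp
  qed
  from this[of UNIV] show ?thesis by (simp add: classical_laplacian_def[abs_def])
qed

text \<open>
  The fundamental lemma of the calculus of variations. The cut-off functions of a box converge
  boundedly to its indicator, so by dominated convergence the integral of \<open>f\<close> over each
  box is zero.
\<close>

lemma AE_zero_if_orthogonal_to_test_functions:
  fixes f :: "real^'n::finite \<Rightarrow> real"
  assumes f: "locally_integrable f"
    and orth: "\<And>\<eta>. test_function \<eta> \<Longrightarrow> (LINT x|lebesgue. f x * \<eta> x) = 0"
  shows "AE x in lebesgue. f x = 0"
proof (rule AE_zero_if_box_integrals_zero)
  show meas: "f \<in> borel_measurable lebesgue" by (rule locally_integrable_measurable[OF f])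
  fix a b :: "real^'n"
  have cb: "integrable lebesgue (\<lambda>x. indicator (cbox a b) x * f x)"
    using f unfolding locally_integrable_def set_integrable_def by auto
  have mb: "(\<lambda>x. f x * indicator (box a b) x) \<in> borel_measurable lebesgue"
    by (intro borel_measurable_times meas borel_measurable_indicator) simp
  have bnd: "AE x in lebesgue. norm (f x * indicator (box a b) x) \<le> norm (indicator (cbox a b) x * f x)"
    using box_subset_cbox[of a b] by (intro always_eventually) (auto simp: indicator_def)
  show "integrable lebesgue (\<lambda>x. f x * indicator (box a b) x)"
    by (rule Bochner_Integration.integrable_bound[OF cb mb bnd])
  have "(\<lambda>n. LINT x|lebesgue. f x * box_cutoff a b n x) \<longlonglongrightarrow> (LINT x|lebesgue. f x * indicator (box a b) x)"
  proof (rule integral_dominated_convergence[OF mb])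
    show "integrable lebesgue (\<lambda>x. \<bar>indicator (cbox a b) x * f x\<bar>)" using cb by simp
    show "(\<lambda>x. f x * box_cutoff a b n x) \<in> borel_measurable lebesgue" for n
      using integrable_times_cont_compact_support[OF f
          test_function_cont_compact_support[OF test_function_box_cutoff]] by auto
    show "AE x in lebesgue. (\<lambda>n. f x * box_cutoff a b n x) \<longlonglongrightarrow> f x * indicator (box a b) x"
      by (intro always_eventually allI tendsto_mult tendsto_const box_cutoff_tendsto)
    show "AE x in lebesgue. norm (f x * box_cutoff a b n x) \<le> \<bar>indicator (cbox a b) x * f x\<bar>" for n
    proof (intro always_eventually allI)
      fix x show "norm (f x * box_cutoff a b n x) \<le> \<bar>indicator (cbox a b) x * f x\<bar>"
        using mult_left_mono[OF box_cutoff_bounds[of a b n x], of "\<bar>f x\<bar>"]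
        by (simp add: abs_mult mult.commute)
    qed
  qed
  then show "(LINT x|lebesgue. f x * indicator (box a b) x) = 0"
    by (simp add: orth[OF test_function_box_cutoff] LIMSEQ_const_iff)
qed

lemma locally_integrable_add:
  "locally_integrable f \<Longrightarrow> locally_integrable g \<Longrightarrow> locally_integrable (\<lambda>x. f x + g x)"
  unfolding locally_integrable_def by (blast intro: set_integral_add)

lemma locally_integrable_cmult:
  "locally_integrable f \<Longrightarrow> locally_integrable (\<lambda>x. c * f x)"
  unfolding locally_integrable_def by simp

lemma locally_integrable_cong_AE:
  assumes "AE x in lebesgue. f x = g x" "locally_integrable g"
  shows "locally_integrable f"
  unfolding locally_integrable_def set_integrable_def
proof (intro allI impI)
  fix C :: "(real^'a) set" assume "compact C"
  then have "integrable lebesgue (\<lambda>x. indicator C x *\<^sub>R g x)"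
    using assms(2) by (simp add: locally_integrable_def set_integrable_def)
  then show "integrable lebesgue (\<lambda>x. indicator C x *\<^sub>R f x)"
    using assms(1) by (elim integrable_lebesgue_cong_AE[rotated]) auto
qed

lemma has_weak_laplacian_add:
  assumes "\<phi> has_weak_laplacian f" "\<psi> has_weak_laplacian g"
  shows "(\<lambda>x. \<phi> x + \<psi> x) has_weak_laplacian (\<lambda>x. f x + g x)"
  using assms unfolding has_weak_laplacian_def
  by (auto simp: locally_integrable_add distrib_right
      Bochner_Integration.integral_add integrable_times_cont_compact_support
      cont_compact_support_laplacian test_function_cont_compact_support)

lemma has_weak_laplacian_cmult:
  assumes "\<phi> has_weak_laplacian f"
  shows "(\<lambda>x. c * \<phi> x) has_weak_laplacian (\<lambda>x. c * f x)"
  using assms unfolding has_weak_laplacian_def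
  by (auto simp: locally_integrable_cmult mult.assoc)

lemma has_weak_laplacian_cong_AE:
  assumes "\<phi> has_weak_laplacian f" "AE x in lebesgue. \<phi>' x = \<phi> x" "AE x in lebesgue. f' x = f x"
  shows "\<phi>' has_weak_laplacian f'"
proof -
  have "(LINT x|lebesgue. \<phi>' x * h x) = (LINT x|lebesgue. \<phi> x * h x)"
       "(LINT x|lebesgue. f' x * h x) = (LINT x|lebesgue. f x * h x)" for h
    using assms(2,3) by (auto intro!: integral_lebesgue_cong_AE)
  then show ?thesis
    using assms locally_integrable_cong_AE unfolding has_weak_laplacian_def by auto
qed

lemma weak_laplacian_unique:
  assumes "\<phi> has_weak_laplacian f" "\<phi> has_weak_laplacian g"
  shows "AE x in lebesgue. f x = g x"
proof -
  have "(\<lambda>x. \<phi> x + - 1 * \<phi> x) has_weak_laplacian (\<lambda>x. f x + - 1 * g x)"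
    using assms has_weak_laplacian_add has_weak_laplacian_cmult by blast
  then have "AE x in lebesgue. f x + - 1 * g x = 0"
    by (intro AE_zero_if_orthogonal_to_test_functions) (auto simp: has_weak_laplacian_def)
  then show ?thesis by eventually_elim simp
qed

text \<open>
  Uniqueness makes the chosen representative \<open>laplacian \<phi>\<close> computable: every norm
  that refers to it can be evaluated with whichever weak Laplacian is at hand.
\<close>

lemma laplacian_eq_AE:
  assumes "\<phi> has_weak_laplacian f"
  shows "AE x in lebesgue. laplacian \<phi> x = f x"
  unfolding laplacian_def
  using assms someI[of "\<lambda>f. \<phi> has_weak_laplacian f" f] weak_laplacian_unique by blast

section \<open>The norm of \<open>H\<^sup>2\<close>\<close>

lemma L2_norm_nonneg: "0 \<le> L2_norm f"
  by (simp add: L2_norm_def)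

lemma L2_norm_cong_AE:
  assumes "AE x in lebesgue. f x = g x"
  shows "L2_norm f = L2_norm g"
  unfolding L2_norm_def using assms by (auto intro!: arg_cong[where f = sqrt] integral_lebesgue_cong_AE)

lemma L2_cong_AE:
  assumes "AE x in lebesgue. f x = g x" "g \<in> L2"
  shows "f \<in> L2"
proof -
  have "f \<in> borel_measurable lebesgue"
    using assms by (intro borel_measurable_lebesgue_cong_AE[OF assms(1)]) (simp add: L2_def)
  moreover have "integrable lebesgue (\<lambda>x. (f x)\<^sup>2)"
    by (rule integrable_lebesgue_cong_AE[of _ "\<lambda>x. (g x)\<^sup>2"]) (use assms in \<open>auto simp: L2_def\<close>)
  ultimately show ?thesis by (simp add: L2_def)
qed

lemma L2_mult_integrable:
  assumes "f \<in> L2" "g \<in> L2"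
  shows "integrable lebesgue (\<lambda>x. f x * g x)"
proof (rule Bochner_Integration.integrable_bound)
  show "integrable lebesgue (\<lambda>x. (f x)\<^sup>2 + (g x)\<^sup>2)"
    using assms by (auto simp: L2_def)
  show "(\<lambda>x. f x * g x) \<in> borel_measurable lebesgue"
    using assms by (auto simp: L2_def)
  show "AE x in lebesgue. norm (f x * g x) \<le> norm ((f x)\<^sup>2 + (g x)\<^sup>2)"
  proof (intro always_eventually allI)
    fix x
    have "2 * (\<bar>f x\<bar> * \<bar>g x\<bar>) \<le> (f x)\<^sup>2 + (g x)\<^sup>2"
      using zero_le_power2[of "\<bar>f x\<bar> - \<bar>g x\<bar>"] by (simp add: power2_diff)
    moreover have "0 \<le> \<bar>f x\<bar> * \<bar>g x\<bar>" by simp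
    ultimately show "norm (f x * g x) \<le> norm ((f x)\<^sup>2 + (g x)\<^sup>2)"
      unfolding real_norm_def abs_mult by linarith
  qed
qed

lemma L2_Cauchy_Schwarz:
  assumes f: "f \<in> L2" and g: "g \<in> L2"
  shows "(LINT x|lebesgue. f x * g x) \<le> L2_norm f * L2_norm g"
proof -
  have sq: "(\<integral>\<^sup>+x. (ennreal \<bar>h x\<bar>)\<^sup>2 \<partial>lebesgue) = ennreal ((L2_norm h)\<^sup>2)" if "h \<in> L2" for h
  proof -
    have "(\<integral>\<^sup>+x. (ennreal \<bar>h x\<bar>)\<^sup>2 \<partial>lebesgue) = (\<integral>\<^sup>+x. ennreal ((h x)\<^sup>2) \<partial>lebesgue)"
      by (simp add: ennreal_power)
    also have "\<dots> = ennreal (LINT x|lebesgue. (h x)\<^sup>2)"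
      using that by (intro nn_integral_eq_integral) (auto simp: L2_def)
    finally show ?thesis by (simp add: L2_norm_def)
  qed
  have int: "integrable lebesgue (\<lambda>x. \<bar>f x * g x\<bar>)" using L2_mult_integrable[OF f g] by simp
  have "ennreal (LINT x|lebesgue. \<bar>f x * g x\<bar>) = (\<integral>\<^sup>+x. ennreal \<bar>f x * g x\<bar> \<partial>lebesgue)"
    by (rule nn_integral_eq_integral[OF int, symmetric]) simp
  also have "\<dots> = (\<integral>\<^sup>+x. ennreal \<bar>f x\<bar> * ennreal \<bar>g x\<bar> \<partial>lebesgue)"
    by (simp add: abs_mult ennreal_mult)
  finally have "(ennreal (LINT x|lebesgue. \<bar>f x * g x\<bar>))\<^sup>2 \<le>
      (\<integral>\<^sup>+x. (ennreal \<bar>f x\<bar>)\<^sup>2 \<partial>lebesgue) * (\<integral>\<^sup>+x. (ennreal \<bar>g x\<bar>)\<^sup>2 \<partial>lebesgue)"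
    using Cauchy_Schwarz_nn_integral[of "\<lambda>x. ennreal \<bar>f x\<bar>" lebesgue "\<lambda>x. ennreal \<bar>g x\<bar>"] f g
    by (simp add: L2_def borel_measurable_abs)
  also have "\<dots> = ennreal ((L2_norm f * L2_norm g)\<^sup>2)"
    by (simp add: sq f g ennreal_mult power_mult_distrib)
  finally have "(LINT x|lebesgue. \<bar>f x * g x\<bar>)\<^sup>2 \<le> (L2_norm f * L2_norm g)\<^sup>2"
    by (simp add: ennreal_power)
  then have "(LINT x|lebesgue. \<bar>f x * g x\<bar>) \<le> L2_norm f * L2_norm g"
    by (rule power2_le_imp_le) (simp add: L2_norm_nonneg)
  moreover have "(LINT x|lebesgue. f x * g x) \<le> (LINT x|lebesgue. \<bar>f x * g x\<bar>)"
    by (intro integral_mono L2_mult_integrable f g int) simp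
  ultimately show ?thesis by linarith
qed

lemma L2_add:
  assumes f: "f \<in> L2" and g: "g \<in> L2"
  shows "(\<lambda>x. f x + g x) \<in> L2" and L2_norm_triangle: "L2_norm (\<lambda>x. f x + g x) \<le> L2_norm f + L2_norm g"
proof -
  have eq: "(f x + g x)\<^sup>2 = ((f x)\<^sup>2 + (g x)\<^sup>2) + 2 * (f x * g x)" for x
    by (simp add: power2_sum)
  have i: "integrable lebesgue (\<lambda>x. (f x)\<^sup>2)" "integrable lebesgue (\<lambda>x. (g x)\<^sup>2)"
    "integrable lebesgue (\<lambda>x. 2 * (f x * g x))"
    using f g L2_mult_integrable[OF f g] by (auto simp: L2_def)
  show fg: "(\<lambda>x. f x + g x) \<in> L2"
    unfolding L2_def mem_Collect_eq eq using f g i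
    by (intro conjI borel_measurable_add Bochner_Integration.integrable_add) (auto simp: L2_def)
  have "(L2_norm (\<lambda>x. f x + g x))\<^sup>2 = (L2_norm f)\<^sup>2 + (L2_norm g)\<^sup>2 + 2 * (LINT x|lebesgue. f x * g x)"
  proof -
    have sq: "(L2_norm h)\<^sup>2 = (LINT x|lebesgue. (h x)\<^sup>2)" for h :: "real^'a \<Rightarrow> real"
      by (simp add: L2_norm_def)
    show ?thesis unfolding sq eq using i by simp
  qed
  also have "\<dots> \<le> (L2_norm f + L2_norm g)\<^sup>2"
    using L2_Cauchy_Schwarz[OF f g] by (simp add: power2_sum)
  finally show "L2_norm (\<lambda>x. f x + g x) \<le> L2_norm f + L2_norm g"
    by (rule power2_le_imp_le) (simp add: L2_norm_nonneg)
qed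

lemma L2_cmult:
  assumes "f \<in> L2"
  shows "(\<lambda>x. c * f x) \<in> L2" and L2_norm_cmult: "L2_norm (\<lambda>x. c * f x) = \<bar>c\<bar> * L2_norm f"
  using assms by (auto simp: L2_def L2_norm_def power_mult_distrib real_sqrt_mult)

lemma L2_norm_eq_0:
  assumes "f \<in> L2" "L2_norm f = 0"
  shows "AE x in lebesgue. f x = 0"
proof -
  have "(LINT x|lebesgue. (f x)\<^sup>2) = 0" using assms(2) by (simp add: L2_norm_def)
  then have "AE x in lebesgue. (f x)\<^sup>2 = 0"
    using assms(1) by (subst (asm) integral_nonneg_eq_0_iff_AE) (auto simp: L2_def)
  then show ?thesis by eventually_elim simp
qed

text \<open>
  Together with the elimination rule below, this replaces the chosen Laplacian in the norm by an
  explicit one.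
\<close>

lemma H2_normI:
  assumes "\<phi> \<in> L2" "f \<in> L2" "\<phi> has_weak_laplacian f"
  shows "\<phi> \<in> H2" "H2_norm \<phi> = sqrt ((L2_norm \<phi>)\<^sup>2 + (L2_norm f)\<^sup>2)"
  using assms L2_norm_cong_AE[OF laplacian_eq_AE[OF assms(3)]]
  by (auto simp: H2_def H2_norm_def)

lemma H2E:
  assumes "\<phi> \<in> H2"
  obtains f where "\<phi> \<in> L2" "f \<in> L2" "\<phi> has_weak_laplacian f"
    "H2_norm \<phi> = sqrt ((L2_norm \<phi>)\<^sup>2 + (L2_norm f)\<^sup>2)"
  using assms H2_normI(2) unfolding H2_def by blast

lemma H2_norm_nonneg: "0 \<le> H2_norm \<phi>"
  by (simp add: H2_norm_def)

lemma L2_norm_le_H2_norm: "L2_norm \<phi> \<le> H2_norm \<phi>"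
  unfolding H2_norm_def by (rule real_le_rsqrt) simp

text \<open>
  The norm is the Euclidean length of the pair of two \<open>L\<^sup>2\<close> norms, so the
  triangle inequality in the plane and that of \<open>L\<^sup>2\<close> combine.
\<close>

lemma H2_add:
  assumes "\<phi> \<in> H2" "\<psi> \<in> H2"
  shows "(\<lambda>x. \<phi> x + \<psi> x) \<in> H2" and H2_norm_triangle: "H2_norm (\<lambda>x. \<phi> x + \<psi> x) \<le> H2_norm \<phi> + H2_norm \<psi>"
proof -
  obtain f where f: "\<phi> \<in> L2" "f \<in> L2" "\<phi> has_weak_laplacian f"
    "H2_norm \<phi> = sqrt ((L2_norm \<phi>)\<^sup>2 + (L2_norm f)\<^sup>2)" using H2E[OF assms(1)] .
  obtain g where g: "\<psi> \<in> L2" "g \<in> L2" "\<psi> has_weak_laplacian g"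
    "H2_norm \<psi> = sqrt ((L2_norm \<psi>)\<^sup>2 + (L2_norm g)\<^sup>2)" using H2E[OF assms(2)] .
  note s = H2_normI[OF L2_add(1)[OF f(1) g(1)] L2_add(1)[OF f(2) g(2)] has_weak_laplacian_add[OF f(3) g(3)]]
  show "(\<lambda>x. \<phi> x + \<psi> x) \<in> H2" by (rule s)
  have "H2_norm (\<lambda>x. \<phi> x + \<psi> x) \<le> sqrt ((L2_norm \<phi> + L2_norm \<psi>)\<^sup>2 + (L2_norm f + L2_norm g)\<^sup>2)"
    unfolding s(2) by (intro real_sqrt_le_mono add_mono power_mono L2_norm_triangle f g L2_norm_nonneg)
  also have "\<dots> \<le> H2_norm \<phi> + H2_norm \<psi>"
    unfolding f(4) g(4) by (rule real_sqrt_sum_squares_triangle_ineq)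
  finally show "H2_norm (\<lambda>x. \<phi> x + \<psi> x) \<le> H2_norm \<phi> + H2_norm \<psi>" .
qed

lemma H2_cmult:
  assumes "\<phi> \<in> H2"
  shows "(\<lambda>x. c * \<phi> x) \<in> H2"
proof -
  obtain f where f: "\<phi> \<in> L2" "f \<in> L2" "\<phi> has_weak_laplacian f" using H2E[OF assms] by metis
  show ?thesis
    by (rule H2_normI[OF L2_cmult(1)[OF f(1)] L2_cmult(1)[OF f(2)] has_weak_laplacian_cmult[OF f(3)]])
qed

lemma H2_diff: "\<phi> \<in> H2 \<Longrightarrow> \<psi> \<in> H2 \<Longrightarrow> (\<lambda>x. \<phi> x - \<psi> x) \<in> H2"
  using H2_add(1)[of \<phi> "\<lambda>x. - 1 * \<psi> x"] H2_cmult[of \<psi> "- 1"] by simp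

lemma H2_norm_cong_AE:
  assumes "\<phi> \<in> H2" "AE x in lebesgue. \<psi> x = \<phi> x"
  shows "H2_norm \<psi> = H2_norm \<phi>"
proof -
  obtain f where f: "\<phi> \<in> L2" "f \<in> L2" "\<phi> has_weak_laplacian f"
    "H2_norm \<phi> = sqrt ((L2_norm \<phi>)\<^sup>2 + (L2_norm f)\<^sup>2)" using H2E[OF assms(1)] .
  have "\<psi> has_weak_laplacian f"
    using has_weak_laplacian_cong_AE[OF f(3) assms(2)] by simp
  note s = H2_normI[OF L2_cong_AE[OF assms(2) f(1)] f(2) this]
  show ?thesis unfolding s(2) f(4) L2_norm_cong_AE[OF assms(2)] ..
qed

text \<open>
  The form in which estimates of the components are summed up.
\<close>

lemma vec_H2_norm_eq: "vec_H2_norm u = L2_set (\<lambda>m. H2_norm (\<lambda>x. u x $ m)) UNIV"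
  by (simp add: vec_H2_norm_def L2_set_def H2_norm_def sum.distrib)

lemma vec_H2_norm_nonneg: "0 \<le> vec_H2_norm u"
  by (simp add: vec_H2_norm_eq)

lemma H2_norm_le_vec_H2_norm: "H2_norm (\<lambda>x. u x $ m) \<le> vec_H2_norm u"
  unfolding vec_H2_norm_eq by (rule member_le_L2_set) auto

lemma vec_H2_add:
  assumes "u \<in> vec_H2" "v \<in> vec_H2"
  shows "(\<lambda>x. u x + v x) \<in> vec_H2"
    and vec_H2_norm_triangle: "vec_H2_norm (\<lambda>x. u x + v x) \<le> vec_H2_norm u + vec_H2_norm v"
proof -
  have uv: "(\<lambda>x. u x $ m) \<in> H2" "(\<lambda>x. v x $ m) \<in> H2" for m
    using assms by (auto simp: vec_H2_def)
  show "(\<lambda>x. u x + v x) \<in> vec_H2"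
    using H2_add(1)[OF uv] by (simp add: vec_H2_def)
  have "vec_H2_norm (\<lambda>x. u x + v x) \<le> L2_set (\<lambda>m. H2_norm (\<lambda>x. u x $ m) + H2_norm (\<lambda>x. v x $ m)) UNIV"
    unfolding vec_H2_norm_eq using H2_norm_triangle[OF uv] by (intro L2_set_mono) (auto simp: H2_norm_nonneg)
  also have "\<dots> \<le> vec_H2_norm u + vec_H2_norm v"
    unfolding vec_H2_norm_eq by (rule L2_set_triangle_ineq)
  finally show "vec_H2_norm (\<lambda>x. u x + v x) \<le> vec_H2_norm u + vec_H2_norm v" .
qed

lemma vec_H2_norm_pos:
  assumes "u \<in> vec_H2" "\<not> (AE x in lebesgue. u x $ m = 0)"
  shows "0 < vec_H2_norm u"
proof -
  have um: "(\<lambda>x. u x $ m) \<in> L2" using assms(1) by (auto simp: vec_H2_def H2_def)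
  then have "L2_norm (\<lambda>x. u x $ m) \<noteq> 0" using L2_norm_eq_0 assms(2) by blast
  then have "0 < L2_norm (\<lambda>x. u x $ m)" using L2_norm_nonneg[of "\<lambda>x. u x $ m"] by linarith
  then show ?thesis
    using L2_norm_le_H2_norm[of "\<lambda>x. u x $ m"] H2_norm_le_vec_H2_norm[of u m] by linarith
qed

lemma norm_L2_le_vec_H2_norm:
  fixes u :: "real^'d::finite \<Rightarrow> real^'N::finite"
  assumes "u \<in> vec_H2"
  shows "(\<lambda>x. norm (u x)) \<in> L2" "L2_norm (\<lambda>x. norm (u x)) \<le> vec_H2_norm u"
proof -
  have um: "(\<lambda>x. u x $ m) \<in> borel_measurable lebesgue" "integrable lebesgue (\<lambda>x. (u x $ m)\<^sup>2)" for m
    using assms by (auto simp: vec_H2_def H2_def L2_def)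
  have eq: "(norm (u x))\<^sup>2 = (\<Sum>m\<in>UNIV. (u x $ m)\<^sup>2)" for x
    by (simp add: norm_vec_def L2_set_def sum_nonneg)
  have int: "integrable lebesgue (\<lambda>x. \<Sum>m\<in>UNIV. (u x $ m)\<^sup>2)"
    using um by (intro Bochner_Integration.integrable_sum) auto
  have "(\<lambda>x. sqrt (\<Sum>m\<in>UNIV. (u x $ m)\<^sup>2)) \<in> borel_measurable lebesgue"
    using measurable_compose[OF borel_measurable_integrable[OF int] borel_measurable_sqrt] .
  then have "(\<lambda>x. norm (u x)) \<in> borel_measurable lebesgue"
    by (simp add: norm_vec_def L2_set_def)
  then show "(\<lambda>x. norm (u x)) \<in> L2"
    using int by (simp add: L2_def eq)
  have "(L2_norm (\<lambda>x. norm (u x)))\<^sup>2 = (LINT x|lebesgue. (norm (u x))\<^sup>2)"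
    by (simp add: L2_norm_def)
  also have "\<dots> = (\<Sum>m\<in>UNIV. LINT x|lebesgue. (u x $ m)\<^sup>2)"
    unfolding eq using um by (intro Bochner_Integration.integral_sum) auto
  also have "\<dots> = (\<Sum>m\<in>UNIV. (L2_norm (\<lambda>x. u x $ m))\<^sup>2)"
    by (simp add: L2_norm_def)
  also have "\<dots> \<le> (\<Sum>m\<in>UNIV. (H2_norm (\<lambda>x. u x $ m))\<^sup>2)"
    by (intro sum_mono power_mono L2_norm_le_H2_norm L2_norm_nonneg)
  also have "\<dots> = (vec_H2_norm u)\<^sup>2"
    by (simp add: vec_H2_norm_eq L2_set_def sum_nonneg)
  finally show "L2_norm (\<lambda>x. norm (u x)) \<le> vec_H2_norm u"
    by (rule power2_le_imp_le) (rule vec_H2_norm_nonneg)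
qed

lemma L2_dominated:
  assumes f: "f \<in> borel_measurable lebesgue" and g: "g \<in> L2" and le: "AE x in lebesgue. \<bar>f x\<bar> \<le> g x"
  shows "f \<in> L2" and L2_norm_mono: "L2_norm f \<le> L2_norm g"
proof -
  have le2: "AE x in lebesgue. (f x)\<^sup>2 \<le> (g x)\<^sup>2"
    using le by eventually_elim (metis abs_ge_zero power2_abs power_mono)
  have gi: "integrable lebesgue (\<lambda>x. (g x)\<^sup>2)" using g by (simp add: L2_def)
  have fi: "integrable lebesgue (\<lambda>x. (f x)\<^sup>2)"
    by (rule Bochner_Integration.integrable_bound[OF gi]) (use f le2 in auto)
  show "f \<in> L2" using f fi by (simp add: L2_def)
  show "L2_norm f \<le> L2_norm g"
    unfolding L2_norm_def by (intro real_sqrt_le_mono integral_mono_AE fi gi le2)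
qed

text \<open>
  The supremum that defines the operator norm is bounded because \<open>T\<close> is. At an element
  of norm \<open>0\<close> the quotient in it carries no information, and there boundedness itself
  gives \<open>H2_norm (T \<phi>) = 0\<close>.
\<close>

lemma H2_norm_bounded_linear:
  assumes T: "H2_bounded_linear T" and \<phi>: "\<phi> \<in> H2"
  shows "T \<phi> \<in> H2" "H2_norm (T \<phi>) \<le> H2_onorm T * H2_norm \<phi>"
proof -
  show "T \<phi> \<in> H2" using T \<phi> by (simp add: H2_bounded_linear_def)
  obtain C where C: "\<And>\<phi>. \<phi> \<in> H2 \<Longrightarrow> H2_norm (T \<phi>) \<le> C * H2_norm \<phi>"
    using T unfolding H2_bounded_linear_def by blast
  have bdd: "bdd_above ((\<lambda>\<phi>. H2_norm (T \<phi>) / H2_norm \<phi>) ` H2)"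
  proof (rule bdd_aboveI2)
    fix \<psi> :: "real^'a \<Rightarrow> real" assume "\<psi> \<in> H2"
    then have "H2_norm (T \<psi>) \<le> C * H2_norm \<psi>" by (rule C)
    also have "\<dots> \<le> \<bar>C\<bar> * H2_norm \<psi>" by (intro mult_right_mono) (auto simp: H2_norm_nonneg)
    finally show "H2_norm (T \<psi>) / H2_norm \<psi> \<le> \<bar>C\<bar>"
      using H2_norm_nonneg[of \<psi>] by (cases "H2_norm \<psi> = 0") (auto simp: divide_le_eq)
  qed
  have le: "H2_norm (T \<phi>) / H2_norm \<phi> \<le> H2_onorm T"
    unfolding H2_onorm_def by (rule cSUP_upper[OF \<phi> bdd])
  show "H2_norm (T \<phi>) \<le> H2_onorm T * H2_norm \<phi>"
  proof (cases "H2_norm \<phi> = 0")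
    case True
    then show ?thesis using C[OF \<phi>] by simp
  next
    case False
    then have "H2_norm \<phi> > 0" using H2_norm_nonneg[of \<phi>] by linarith
    then show ?thesis using le by (simp add: divide_le_eq)
  qed
qed

lemma H2_bounded_linear_diff:
  assumes T: "H2_bounded_linear T" and "\<phi> \<in> H2" "\<psi> \<in> H2"
  shows "AE x in lebesgue. T (\<lambda>y. \<phi> y - \<psi> y) x = T \<phi> x - T \<psi> x"
proof -
  have "AE x in lebesgue. T (\<lambda>y. \<phi> y + - 1 * \<psi> y) x = T \<phi> x + T (\<lambda>y. - 1 * \<psi> y) x"
    using T unfolding H2_bounded_linear_def
    by (elim conjE) (drule bspec[OF _ assms(2)], drule bspec[OF _ H2_cmult[OF assms(3), of "- 1"]], assumption)
  moreover have "AE x in lebesgue. T (\<lambda>y. - 1 * \<psi> y) x = - 1 * T \<psi> x"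
    using T unfolding H2_bounded_linear_def
    by (elim conjE) (drule spec[of _ "- 1"], drule bspec[OF _ assms(3)], assumption)
  ultimately show ?thesis by eventually_elim simp
qed

section \<open>Convolution with an integrable kernel\<close>

lemma nn_integral_lborel_reflect:
  fixes f :: "'a::euclidean_space \<Rightarrow> ennreal"
  assumes [measurable]: "f \<in> borel_measurable borel"
  shows "(\<integral>\<^sup>+y. f (x - y) \<partial>lborel) = (\<integral>\<^sup>+y. f y \<partial>lborel)"
proof -
  have "lborel = distr lborel borel (\<lambda>y::'a. x - y)"
    using lborel_affine[of "-1" x] by (simp add: density_1)
  then have "(\<integral>\<^sup>+y. f y \<partial>lborel) = (\<integral>\<^sup>+y. f y \<partial>distr lborel borel (\<lambda>y. x - y))"
    by simp
  also have "\<dots> = (\<integral>\<^sup>+y. f (x - y) \<partial>lborel)"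
    by (rule nn_integral_distr) auto
  finally show ?thesis by simp
qed

lemma nn_integral_lborel_translate:
  fixes f :: "'a::euclidean_space \<Rightarrow> ennreal"
  assumes [measurable]: "f \<in> borel_measurable borel"
  shows "(\<integral>\<^sup>+x. f (x - y) \<partial>lborel) = (\<integral>\<^sup>+x. f x \<partial>lborel)"
proof -
  have "(\<integral>\<^sup>+x. f x \<partial>lborel) = (\<integral>\<^sup>+x. f x \<partial>distr lborel borel ((+) (- y)))"
    by (simp only: lborel_distr_plus)
  also have "\<dots> = (\<integral>\<^sup>+x. f (- y + x) \<partial>lborel)"
    by (rule nn_integral_distr) auto
  finally show ?thesis by simp
qed

lemma integral_lborel_translate:
  fixes f :: "'a::euclidean_space \<Rightarrow> real"
  assumes [measurable]: "f \<in> borel_measurable borel"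
  shows "(LINT x|lborel. f (x + y)) = (LINT x|lborel. f x)"
proof -
  have "(LINT x|lborel. f x) = (LINT x|distr lborel borel ((+) y). f x)"
    by (simp only: lborel_distr_plus)
  also have "\<dots> = (LINT x|lborel. f (y + x))"
    by (rule integral_distr) auto
  finally show ?thesis by (simp add: add.commute)
qed

lemma AE_lborel_reflect:
  fixes P :: "'a::euclidean_space \<Rightarrow> bool"
  assumes "AE y in lborel. P y"
  shows "AE y in lborel. P (x - y)"
proof -
  obtain N where N: "{y \<in> space lborel. \<not> P y} \<subseteq> N" "N \<in> sets lborel" "emeasure lborel N = 0"
    using AE_E[OF assms] by metis
  have [measurable]: "N \<in> sets borel" using N(2) by simp
  have "(\<integral>\<^sup>+y. indicator N (x - y) \<partial>lborel) = (\<integral>\<^sup>+y. indicator N y \<partial>lborel)"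
    by (rule nn_integral_lborel_reflect) simp
  also have "\<dots> = 0" using N by simp
  finally have "AE y in lborel. indicator N (x - y) = (0::ennreal)"
    by (subst (asm) nn_integral_0_iff_AE) auto
  then show ?thesis
    by eventually_elim (use N(1) in \<open>auto simp: indicator_def split: if_splits\<close>)
qed

text \<open>
  Young's inequality, squared. Split the kernel as \<open>\<bar>K\<bar> = sqrt \<bar>K\<bar> * sqrt
  \<bar>K\<bar>\<close> and apply Cauchy-Schwarz, which bounds the square of the convolution of
  \<open>\<bar>K\<bar>\<close> with \<open>\<bar>f\<bar>\<close> by the \<open>L\<^sup>1\<close>
  norm of \<open>K\<close> times the convolution of \<open>\<bar>K\<bar>\<close> with
  \<open>f\<^sup>2\<close>. Integrating the latter by Tonelli's theorem produces the
  \<open>L\<^sup>1\<close> norm of \<open>K\<close> once more. The statement with nonnegative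
  integrals also carries all integrability claims below.
\<close>

lemma Young_nn_integral:
  fixes K f :: "'a::euclidean_space \<Rightarrow> real"
  assumes [measurable]: "K \<in> borel_measurable borel" "f \<in> borel_measurable borel"
  shows "(\<integral>\<^sup>+x. (\<integral>\<^sup>+y. ennreal \<bar>K (x - y) * f y\<bar> \<partial>lborel)\<^sup>2 \<partial>lborel)
    \<le> (\<integral>\<^sup>+x. ennreal \<bar>K x\<bar> \<partial>lborel)\<^sup>2 * (\<integral>\<^sup>+x. ennreal ((f x)\<^sup>2) \<partial>lborel)"
proof -
  define A where "A = (\<integral>\<^sup>+x. ennreal \<bar>K x\<bar> \<partial>lborel)"
  have pw: "(\<integral>\<^sup>+y. ennreal \<bar>K (x - y) * f y\<bar> \<partial>lborel)\<^sup>2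
      \<le> A * (\<integral>\<^sup>+y. ennreal \<bar>K (x - y)\<bar> * ennreal ((f y)\<^sup>2) \<partial>lborel)" for x
  proof -
    let ?F = "\<lambda>y. ennreal (sqrt \<bar>K (x - y)\<bar>)" and ?G = "\<lambda>y. ennreal (sqrt \<bar>K (x - y)\<bar> * \<bar>f y\<bar>)"
    have "(\<integral>\<^sup>+y. ?F y * ?G y \<partial>lborel)\<^sup>2 \<le> (\<integral>\<^sup>+y. (?F y)\<^sup>2 \<partial>lborel) * (\<integral>\<^sup>+y. (?G y)\<^sup>2 \<partial>lborel)"
      by (rule Cauchy_Schwarz_nn_integral) auto
    moreover have "?F y * ?G y = ennreal \<bar>K (x - y) * f y\<bar>" for y
      by (simp add: abs_mult flip: ennreal_mult mult.assoc)
    moreover have "(?F y)\<^sup>2 = ennreal \<bar>K (x - y)\<bar>" for y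
      by (simp add: ennreal_power)
    moreover have "(?G y)\<^sup>2 = ennreal \<bar>K (x - y)\<bar> * ennreal ((f y)\<^sup>2)" for y
      by (simp add: ennreal_power power_mult_distrib flip: ennreal_mult)
    moreover have "(\<integral>\<^sup>+y. ennreal \<bar>K (x - y)\<bar> \<partial>lborel) = A"
      unfolding A_def by (rule nn_integral_lborel_reflect) simp
    ultimately show ?thesis by simp
  qed
  have "(\<integral>\<^sup>+x. (\<integral>\<^sup>+y. ennreal \<bar>K (x - y) * f y\<bar> \<partial>lborel)\<^sup>2 \<partial>lborel)
    \<le> (\<integral>\<^sup>+x. A * (\<integral>\<^sup>+y. ennreal \<bar>K (x - y)\<bar> * ennreal ((f y)\<^sup>2) \<partial>lborel) \<partial>lborel)"
    by (intro nn_integral_mono pw)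
  also have "\<dots> = A * (\<integral>\<^sup>+x. (\<integral>\<^sup>+y. ennreal \<bar>K (x - y)\<bar> * ennreal ((f y)\<^sup>2) \<partial>lborel) \<partial>lborel)"
    by (rule nn_integral_cmult) measurable
  also have "(\<integral>\<^sup>+x. (\<integral>\<^sup>+y. ennreal \<bar>K (x - y)\<bar> * ennreal ((f y)\<^sup>2) \<partial>lborel) \<partial>lborel)
      = (\<integral>\<^sup>+y. (\<integral>\<^sup>+x. ennreal \<bar>K (x - y)\<bar> * ennreal ((f y)\<^sup>2) \<partial>lborel) \<partial>lborel)"
    by (rule lborel_pair.Fubini'[symmetric]) measurable
  also have "\<dots> = (\<integral>\<^sup>+y. A * ennreal ((f y)\<^sup>2) \<partial>lborel)"
  proof (rule nn_integral_cong)
    fix y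
    have "(\<integral>\<^sup>+x. ennreal \<bar>K (x - y)\<bar> * ennreal ((f y)\<^sup>2) \<partial>lborel)
        = (\<integral>\<^sup>+x. ennreal \<bar>K (x - y)\<bar> \<partial>lborel) * ennreal ((f y)\<^sup>2)"
      by (rule nn_integral_multc) measurable
    also have "(\<integral>\<^sup>+x. ennreal \<bar>K (x - y)\<bar> \<partial>lborel) = A"
      unfolding A_def by (rule nn_integral_lborel_translate) simp
    finally show "(\<integral>\<^sup>+x. ennreal \<bar>K (x - y)\<bar> * ennreal ((f y)\<^sup>2) \<partial>lborel) = A * ennreal ((f y)\<^sup>2)" .
  qed
  also have "\<dots> = A * (\<integral>\<^sup>+y. ennreal ((f y)\<^sup>2) \<partial>lborel)"
    by (rule nn_integral_cmult) measurable
  finally show ?thesis unfolding A_def by (simp add: power2_eq_square mult.assoc)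
qed

lemma convolution_square_integrable_borel:
  fixes K f :: "'a::euclidean_space \<Rightarrow> real"
  assumes [measurable]: "K \<in> borel_measurable borel" "f \<in> borel_measurable borel"
    and K: "integrable lborel K" and f: "integrable lborel (\<lambda>x. (f x)\<^sup>2)"
  defines "g \<equiv> \<lambda>x. LINT y|lborel. K (x - y) * f y"
  shows "g \<in> borel_measurable borel" "integrable lborel (\<lambda>x. (g x)\<^sup>2)"
    "(LINT x|lborel. (g x)\<^sup>2) \<le> (LINT x|lborel. \<bar>K x\<bar>)\<^sup>2 * (LINT x|lborel. (f x)\<^sup>2)"
proof -
  have g_meas[measurable]: "g \<in> borel_measurable borel"
    unfolding g_def by measurable
  have le: "ennreal \<bar>g x\<bar> \<le> (\<integral>\<^sup>+y. ennreal \<bar>K (x - y) * f y\<bar> \<partial>lborel)" for x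
  proof (cases "integrable lborel (\<lambda>y. K (x - y) * f y)")
    case True
    from integral_norm_bound_ennreal[OF this] show ?thesis by (simp add: g_def)
  qed (simp add: g_def not_integrable_integral_eq)
  have "(\<integral>\<^sup>+x. ennreal ((g x)\<^sup>2) \<partial>lborel)
      \<le> (\<integral>\<^sup>+x. (\<integral>\<^sup>+y. ennreal \<bar>K (x - y) * f y\<bar> \<partial>lborel)\<^sup>2 \<partial>lborel)"
  proof (intro nn_integral_mono)
    fix x
    have "ennreal ((g x)\<^sup>2) = ennreal \<bar>g x\<bar> * ennreal \<bar>g x\<bar>"
      by (simp add: power2_eq_square flip: ennreal_mult)
    also have "\<dots> \<le> (\<integral>\<^sup>+y. ennreal \<bar>K (x - y) * f y\<bar> \<partial>lborel)\<^sup>2"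
      unfolding power2_eq_square by (intro mult_mono le) auto
    finally show "ennreal ((g x)\<^sup>2) \<le> (\<integral>\<^sup>+y. ennreal \<bar>K (x - y) * f y\<bar> \<partial>lborel)\<^sup>2" .
  qed
  also have "\<dots> \<le> (\<integral>\<^sup>+x. ennreal \<bar>K x\<bar> \<partial>lborel)\<^sup>2 * (\<integral>\<^sup>+x. ennreal ((f x)\<^sup>2) \<partial>lborel)"
    by (rule Young_nn_integral) auto
  also have "(\<integral>\<^sup>+x. ennreal \<bar>K x\<bar> \<partial>lborel) = ennreal (LINT x|lborel. \<bar>K x\<bar>)"
    using K by (intro nn_integral_eq_integral) auto
  also have "(\<integral>\<^sup>+x. ennreal ((f x)\<^sup>2) \<partial>lborel) = ennreal (LINT x|lborel. (f x)\<^sup>2)"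
    using f by (intro nn_integral_eq_integral) auto
  also have "(ennreal (LINT x|lborel. \<bar>K x\<bar>))\<^sup>2 * ennreal (LINT x|lborel. (f x)\<^sup>2) =
      ennreal ((LINT x|lborel. \<bar>K x\<bar>)\<^sup>2 * (LINT x|lborel. (f x)\<^sup>2))"
    by (simp add: ennreal_power ennreal_mult)
  finally have le: "(\<integral>\<^sup>+x. ennreal ((g x)\<^sup>2) \<partial>lborel)
    \<le> ennreal ((LINT x|lborel. \<bar>K x\<bar>)\<^sup>2 * (LINT x|lborel. (f x)\<^sup>2))" .
  show "g \<in> borel_measurable borel" by (rule g_meas)
  show int: "integrable lborel (\<lambda>x. (g x)\<^sup>2)"
    using le by (intro integrableI_nonneg) (auto simp: less_top[symmetric] top_unique)
  show "(LINT x|lborel. (g x)\<^sup>2) \<le> (LINT x|lborel. \<bar>K x\<bar>)\<^sup>2 * (LINT x|lborel. (f x)\<^sup>2)"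
    using le nn_integral_eq_integral[OF int] by simp
qed

text \<open>
  Moves the convolution to the other factor. Fubini's theorem applies since \<open>K (x - y) * f y *
  \<psi> x\<close> is integrable in \<open>(x, y)\<close>: by Young's inequality the integral over
  \<open>y\<close> of its absolute value is a product of two square integrable functions of
  \<open>x\<close>.
\<close>

lemma integral_convolution_mult_borel:
  fixes K f \<psi> :: "'a::euclidean_space \<Rightarrow> real"
  assumes [measurable]: "K \<in> borel_measurable borel" "f \<in> borel_measurable borel" "\<psi> \<in> borel_measurable borel"
    and K: "integrable lborel K" and f: "integrable lborel (\<lambda>x. (f x)\<^sup>2)"
    and \<psi>: "integrable lborel (\<lambda>x. (\<psi> x)\<^sup>2)"
  shows "(LINT x|lborel. (LINT y|lborel. K (x - y) * f y) * \<psi> x) =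
    (LINT y|lborel. f y * (LINT z|lborel. K z * \<psi> (z + y)))"
proof -
  let ?N = "\<lambda>x. \<integral>\<^sup>+y. ennreal \<bar>K (x - y) * f y\<bar> \<partial>lborel"
  have int: "integrable (lborel \<Otimes>\<^sub>M lborel) (\<lambda>(x, y). K (x - y) * f y * \<psi> x)"
  proof (rule integrableI_bounded)
    show "(\<lambda>(x, y). K (x - y) * f y * \<psi> x) \<in> borel_measurable (lborel \<Otimes>\<^sub>M lborel)"
      by measurable
    have "(\<integral>\<^sup>+p. ennreal (norm (case p of (x, y) \<Rightarrow> K (x - y) * f y * \<psi> x)) \<partial>(lborel \<Otimes>\<^sub>M lborel))
       = (\<integral>\<^sup>+x. (\<integral>\<^sup>+y. ennreal (norm (K (x - y) * f y * \<psi> x)) \<partial>lborel) \<partial>lborel)"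
      by (subst lborel.nn_integral_fst[symmetric]) auto
    also have "\<dots> = (\<integral>\<^sup>+x. ?N x * ennreal \<bar>\<psi> x\<bar> \<partial>lborel)"
      by (intro nn_integral_cong, subst nn_integral_multc[symmetric])
        (auto simp: abs_mult ennreal_mult)
    finally have eq: "(\<integral>\<^sup>+p. ennreal (norm (case p of (x, y) \<Rightarrow> K (x - y) * f y * \<psi> x)) \<partial>(lborel \<Otimes>\<^sub>M lborel))
       = (\<integral>\<^sup>+x. ?N x * ennreal \<bar>\<psi> x\<bar> \<partial>lborel)" .
    have "(\<integral>\<^sup>+x. ?N x * ennreal \<bar>\<psi> x\<bar> \<partial>lborel)\<^sup>2
        \<le> (\<integral>\<^sup>+x. (?N x)\<^sup>2 \<partial>lborel) * (\<integral>\<^sup>+x. (ennreal \<bar>\<psi> x\<bar>)\<^sup>2 \<partial>lborel)"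
      by (rule Cauchy_Schwarz_nn_integral) measurable
    also have "\<dots> \<le> ((\<integral>\<^sup>+x. ennreal \<bar>K x\<bar> \<partial>lborel)\<^sup>2 * (\<integral>\<^sup>+x. ennreal ((f x)\<^sup>2) \<partial>lborel))
        * (\<integral>\<^sup>+x. ennreal ((\<psi> x)\<^sup>2) \<partial>lborel)"
      by (intro mult_mono Young_nn_integral) (auto simp: ennreal_power)
    also have "\<dots> < \<infinity>"
    proof -
      have "(\<integral>\<^sup>+x. ennreal \<bar>K x\<bar> \<partial>lborel) < \<infinity>" "(\<integral>\<^sup>+x. ennreal ((f x)\<^sup>2) \<partial>lborel) < \<infinity>"
        "(\<integral>\<^sup>+x. ennreal ((\<psi> x)\<^sup>2) \<partial>lborel) < \<infinity>"
        using K f \<psi> by (auto simp: integrable_iff_bounded)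
      then show ?thesis by (auto simp: ennreal_mult_less_top power_less_top_ennreal)
    qed
    finally show "(\<integral>\<^sup>+p. ennreal (norm (case p of (x, y) \<Rightarrow> K (x - y) * f y * \<psi> x)) \<partial>(lborel \<Otimes>\<^sub>M lborel)) < \<infinity>"
      unfolding eq by (simp add: power_less_top_ennreal)
  qed
  have "(LINT x|lborel. (LINT y|lborel. K (x - y) * f y) * \<psi> x)
      = (LINT x|lborel. (LINT y|lborel. K (x - y) * f y * \<psi> x))"
    by simp
  also have "\<dots> = (LINT y|lborel. (LINT x|lborel. K (x - y) * f y * \<psi> x))"
    by (rule lborel_pair.Fubini_integral[OF int, symmetric])
  also have "\<dots> = (LINT y|lborel. f y * (LINT z|lborel. K z * \<psi> (z + y)))"
  proof (rule Bochner_Integration.integral_cong[OF refl])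
    fix y
    have "(LINT x|lborel. K (x - y) * f y * \<psi> x) = (LINT z|lborel. K (z + y - y) * f y * \<psi> (z + y))"
      by (rule integral_lborel_translate[symmetric]) measurable
    also have "\<dots> = (LINT z|lborel. f y * (K z * \<psi> (z + y)))"
      by (simp add: algebra_simps)
    finally show "(LINT x|lborel. K (x - y) * f y * \<psi> x) = f y * (LINT z|lborel. K z * \<psi> (z + y))"
      by simp
  qed
  finally show ?thesis .
qed

definition convolution :: "(real^'d::finite \<Rightarrow> real) \<Rightarrow> (real^'d \<Rightarrow> real) \<Rightarrow> real^'d \<Rightarrow> real" where
  "convolution K f x = (LINT y|lebesgue. K (x - y) * f y)"

text \<open>
  The convolution depends at every point only on the classes of \<open>K\<close> and
  \<open>f\<close>. Fubini's theorem can therefore be applied to Borel representatives, which live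
  on the product of the Borel measure spaces.
\<close>

lemma convolution_cong_AE:
  assumes "AE x in lebesgue. K x = K' x" "AE x in lebesgue. f x = f' x"
  shows "convolution K f x = convolution K' f' x"
proof -
  have "AE y in lborel. K (x - y) = K' (x - y)"
    using assms(1) unfolding AE_completion_iff by (rule AE_lborel_reflect)
  then have "AE y in lebesgue. K (x - y) = K' (x - y)" by (rule AE_completion)
  with assms(2) have "AE y in lebesgue. K (x - y) * f y = K' (x - y) * f' y"
    by eventually_elim simp
  then show ?thesis unfolding convolution_def by (rule integral_lebesgue_cong_AE)
qed

lemma convolution_borel:
  assumes [measurable]: "K \<in> borel_measurable borel" "f \<in> borel_measurable borel"
  shows "convolution K f x = (LINT y|lborel. K (x - y) * f y)"
  unfolding convolution_def by (rule integral_completion) measurable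

lemma L2_locally_integrable:
  assumes "f \<in> L2"
  shows "locally_integrable f"
  unfolding locally_integrable_def set_integrable_def
proof (intro allI impI)
  fix C :: "(real^'a) set" assume C: "compact C"
  have m: "f \<in> borel_measurable lebesgue" and i: "integrable lebesgue (\<lambda>x. (f x)\<^sup>2)"
    using assms by (auto simp: L2_def)
  have C1: "C \<in> sets lebesgue" and C2: "emeasure lebesgue C < \<infinity>"
    using lmeasurable_compact[OF C] by (auto simp: fmeasurable_def)
  have "integrable lebesgue (\<lambda>x. indicator C x + (f x)\<^sup>2 :: real)"
    using C1 C2 i by (intro Bochner_Integration.integrable_add) auto
  then show "integrable lebesgue (\<lambda>x. indicator C x *\<^sub>R f x)"
  proof (rule Bochner_Integration.integrable_bound)
    show "(\<lambda>x. indicator C x *\<^sub>R f x) \<in> borel_measurable lebesgue"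
      using m C1 by (intro borel_measurable_scaleR borel_measurable_indicator)
    show "AE x in lebesgue. norm (indicator C x *\<^sub>R f x) \<le> norm (indicator C x + (f x)\<^sup>2 :: real)"
    proof (intro always_eventually allI)
      fix x
      have "\<bar>f x\<bar> \<le> 1 + (f x)\<^sup>2"
        using zero_le_power2[of "\<bar>f x\<bar> - 1/2"] by (simp add: power2_eq_square algebra_simps)
      then show "norm (indicator C x *\<^sub>R f x) \<le> norm (indicator C x + (f x)\<^sup>2 :: real)"
        by (auto simp: indicator_def)
    qed
  qed
qed

lemma cont_compact_support_square_integrable:
  assumes "cont_compact_support \<psi>"
  shows "integrable lborel (\<lambda>x. (\<psi> x)\<^sup>2)"
proof -
  obtain C B where C: "compact C" "\<And>x. x \<notin> C \<Longrightarrow> \<psi> x = 0" "\<And>x. \<bar>\<psi> x\<bar> \<le> B" "B \<ge> 0"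
    by (rule cont_compact_support_bounded[OF assms]) (rule that)
  have "integrable lborel (\<lambda>x. B\<^sup>2 * indicator C x :: real)"
    using C(1) emeasure_lborel_cbox_finite emeasure_compact_finite[OF C(1)]
    by (intro integrable_mult_right) (auto simp: compact_imp_closed less_top)
  then show ?thesis
  proof (rule Bochner_Integration.integrable_bound)
    show "(\<lambda>x. (\<psi> x)\<^sup>2) \<in> borel_measurable lborel"
      using cont_compact_support_borel[OF assms] by measurable
    show "AE x in lborel. norm ((\<psi> x)\<^sup>2) \<le> norm (B\<^sup>2 * indicator C x :: real)"
    proof (intro always_eventually allI)
      fix x show "norm ((\<psi> x)\<^sup>2) \<le> norm (B\<^sup>2 * indicator C x :: real)"
        using C(2)[of x] power_mono[OF C(3)[of x], of 2] by (cases "x \<in> C") auto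
    qed
  qed
qed

lemma L2_borel_representative:
  assumes "f \<in> L2"
  obtains g where "g \<in> borel_measurable borel" "AE x in lebesgue. f x = g x"
    "integrable lborel (\<lambda>x. (g x)\<^sup>2)" "(LINT x|lborel. (g x)\<^sup>2) = (L2_norm f)\<^sup>2"
proof -
  have m: "f \<in> borel_measurable lebesgue" and i: "integrable lebesgue (\<lambda>x. (f x)\<^sup>2)"
    using assms by (auto simp: L2_def)
  obtain g where g[measurable]: "g \<in> borel_measurable borel" and fg: "AE x in lebesgue. f x = g x"
    using lebesgue_borel_representative[OF m] .
  have "integrable lebesgue (\<lambda>x. (g x)\<^sup>2)"
    using fg by (intro integrable_lebesgue_cong_AE[OF _ i]) auto
  then have 1: "integrable lborel (\<lambda>x. (g x)\<^sup>2)" by (subst (asm) integrable_completion) auto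
  have "(LINT x|lborel. (g x)\<^sup>2) = (LINT x|lebesgue. (g x)\<^sup>2)"
    by (rule integral_completion[symmetric]) measurable
  also have "\<dots> = (LINT x|lebesgue. (f x)\<^sup>2)"
    using fg by (intro integral_lebesgue_cong_AE) auto
  also have "\<dots> = (L2_norm f)\<^sup>2"
    by (simp add: L2_norm_def)
  finally show ?thesis using that g fg 1 by blast
qed

lemma L1_borel_representative:
  assumes "K \<in> L1"
  obtains g where "g \<in> borel_measurable borel" "AE x in lebesgue. K x = g x"
    "integrable lborel g" "(LINT x|lborel. \<bar>g x\<bar>) = L1_norm K"
proof -
  have i: "integrable lebesgue K" using assms by (auto simp: L1_def)
  obtain g where g[measurable]: "g \<in> borel_measurable borel" and fg: "AE x in lebesgue. K x = g x"
    using lebesgue_borel_representative[OF borel_measurable_integrable[OF i]] .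
  have "integrable lebesgue g"
    using fg by (intro integrable_lebesgue_cong_AE[OF _ i]) auto
  then have 1: "integrable lborel g" by (subst (asm) integrable_completion) auto
  have "(LINT x|lborel. \<bar>g x\<bar>) = (LINT x|lebesgue. \<bar>g x\<bar>)"
    by (rule integral_completion[symmetric]) measurable
  also have "\<dots> = L1_norm K" unfolding L1_norm_def
    using fg by (intro integral_lebesgue_cong_AE) auto
  finally show ?thesis using that g fg 1 by blast
qed

lemma convolution_L2:
  assumes K: "K \<in> L1" and f: "f \<in> L2"
  shows "convolution K f \<in> L2" "L2_norm (convolution K f) \<le> L1_norm K * L2_norm f"
proof -
  obtain k where k: "k \<in> borel_measurable borel" "AE x in lebesgue. K x = k x"
    "integrable lborel k" "(LINT x|lborel. \<bar>k x\<bar>) = L1_norm K"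
    using L1_borel_representative[OF K] .
  obtain g where g: "g \<in> borel_measurable borel" "AE x in lebesgue. f x = g x"
    "integrable lborel (\<lambda>x. (g x)\<^sup>2)" "(LINT x|lborel. (g x)\<^sup>2) = (L2_norm f)\<^sup>2"
    using L2_borel_representative[OF f] .
  let ?h = "\<lambda>x. LINT y|lborel. k (x - y) * g y"
  have eq: "convolution K f = ?h"
    using convolution_cong_AE[OF k(2) g(2)] convolution_borel[OF k(1) g(1)] by (simp add: fun_eq_iff)
  note h = convolution_square_integrable_borel[OF k(1) g(1) k(3) g(3)]
  have h2: "(\<lambda>x. (?h x)\<^sup>2) \<in> borel_measurable lborel"
    using h(1) by (intro borel_measurable_power) simp
  show "convolution K f \<in> L2"
    unfolding eq L2_def using h(2) measurable_completion[of ?h lborel borel] h(1) integrable_completion[OF h2]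
    by simp
  have "(L2_norm ?h)\<^sup>2 = (LINT x|lborel. (?h x)\<^sup>2)"
    using integral_completion[OF h2] by (simp add: L2_norm_def)
  also have "\<dots> \<le> (L1_norm K * L2_norm f)\<^sup>2"
    using h(3) by (simp add: k g power_mult_distrib)
  finally show "L2_norm (convolution K f) \<le> L1_norm K * L2_norm f"
    unfolding eq by (rule power2_le_imp_le) (simp add: L1_norm_def L2_norm_def)
qed

text \<open>
  After the convolution is moved to the test function \<open>\<eta>\<close>, what remains for each
  \<open>y\<close> is the definition of the weak Laplacian of \<open>K\<close>, applied to the
  translate of \<open>\<eta>\<close> by \<open>y\<close>.
\<close>

lemma convolution_has_weak_laplacian:
  assumes K: "K \<in> L1" and H: "H \<in> L1" and KH: "K has_weak_laplacian H" and f: "f \<in> L2"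
  shows "convolution K f has_weak_laplacian convolution H f"
  unfolding has_weak_laplacian_def
proof (intro conjI allI impI)
  show "locally_integrable (convolution K f)" "locally_integrable (convolution H f)"
    using convolution_L2 K H f L2_locally_integrable by blast+
  fix \<eta> :: "real^'a \<Rightarrow> real" assume \<eta>: "test_function \<eta>"
  obtain k where k: "k \<in> borel_measurable borel" "AE x in lebesgue. K x = k x" "integrable lborel k"
    using L1_borel_representative[OF K] by metis
  obtain h where h: "h \<in> borel_measurable borel" "AE x in lebesgue. H x = h x" "integrable lborel h"
    using L1_borel_representative[OF H] by metis
  obtain g where g: "g \<in> borel_measurable borel" "AE x in lebesgue. f x = g x"
    "integrable lborel (\<lambda>x. (g x)\<^sup>2)"
    using L2_borel_representative[OF f] by metis
  have kh: "k has_weak_laplacian h"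
  proof (rule has_weak_laplacian_cong_AE[OF KH])
    show "AE x in lebesgue. k x = K x" using k(2) by eventually_elim simp
    show "AE x in lebesgue. h x = H x" using h(2) by eventually_elim simp
  qed
  have conv: "(LINT x|lebesgue. convolution L f x * \<psi> x) =
      (LINT y|lborel. g y * (LINT z|lborel. l z * \<psi> (z + y)))"
    if l: "l \<in> borel_measurable borel" "AE x in lebesgue. L x = l x" "integrable lborel l"
      and \<psi>: "cont_compact_support \<psi>" for L l \<psi>
  proof -
    have "convolution L f = (\<lambda>x. LINT y|lborel. l (x - y) * g y)"
      using convolution_cong_AE[OF l(2) g(2)] convolution_borel[OF l(1) g(1)] by (simp add: fun_eq_iff)
    moreover have "(LINT x|lebesgue. (LINT y|lborel. l (x - y) * g y) * \<psi> x)
        = (LINT x|lborel. (LINT y|lborel. l (x - y) * g y) * \<psi> x)"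
      using convolution_square_integrable_borel(1)[OF l(1) g(1) l(3) g(3)] cont_compact_support_borel[OF \<psi>]
      by (intro integral_completion borel_measurable_times) simp_all
    ultimately show ?thesis
      using integral_convolution_mult_borel[OF l(1) g(1) cont_compact_support_borel[OF \<psi>] l(3) g(3)
          cont_compact_support_square_integrable[OF \<psi>]] by simp
  qed
  have "(LINT z|lborel. k z * classical_laplacian \<eta> (z + y)) = (LINT z|lborel. h z * \<eta> (z + y))" for y
  proof -
    have borel: "(LINT z|lborel. p z * q z) = (LINT z|lebesgue. p z * q z)"
      if "p \<in> borel_measurable borel" "q \<in> borel_measurable borel" for p q :: "real^'a \<Rightarrow> real"
      using that by (intro integral_completion[symmetric]) simp
    have ty: "test_function (\<lambda>x. \<eta> (x + y))" by (rule test_function_translate[OF \<eta>])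
    then have "(LINT z|lebesgue. k z * classical_laplacian (\<lambda>x. \<eta> (x + y)) z)
        = (LINT z|lebesgue. h z * \<eta> (z + y))"
      using kh by (auto simp: has_weak_laplacian_def)
    moreover have "(\<lambda>z. \<eta> (z + y)) \<in> borel_measurable borel"
      "(\<lambda>z. classical_laplacian \<eta> (z + y)) \<in> borel_measurable borel"
      using cont_compact_support_borel cont_compact_support_translate
        cont_compact_support_laplacian[OF \<eta>] test_function_cont_compact_support[OF \<eta>] by blast+
    ultimately show ?thesis
      using k(1) h(1) by (simp add: borel classical_laplacian_translate[OF \<eta>])
  qed
  then show "(LINT x|lebesgue. convolution K f x * classical_laplacian \<eta> x) =
      (LINT x|lebesgue. convolution H f x * \<eta> x)"
    by (simp add: conv[OF k cont_compact_support_laplacian[OF \<eta>]]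
        conv[OF h test_function_cont_compact_support[OF \<eta>]])
qed

text \<open>
  Young's inequality makes the integral of the absolute value finite at almost every point.
  Linearity of the convolution in its second argument holds at these points.
\<close>

lemma AE_convolution_integrable:
  assumes K: "K \<in> L1" and f: "f \<in> L2"
  shows "AE x in lebesgue. integrable lebesgue (\<lambda>y. K (x - y) * f y)"
proof -
  obtain k where k[measurable]: "k \<in> borel_measurable borel" and Kk: "AE x in lebesgue. K x = k x"
    and ki: "integrable lborel k"
    using L1_borel_representative[OF K] by metis
  obtain g where g[measurable]: "g \<in> borel_measurable borel" and fg: "AE x in lebesgue. f x = g x"
    and gi: "integrable lborel (\<lambda>x. (g x)\<^sup>2)"
    using L2_borel_representative[OF f] by metis
  let ?N = "\<lambda>x. \<integral>\<^sup>+y. ennreal \<bar>k (x - y) * g y\<bar> \<partial>lborel"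
  have "(\<integral>\<^sup>+x. (?N x)\<^sup>2 \<partial>lborel)
      \<le> (\<integral>\<^sup>+x. ennreal \<bar>k x\<bar> \<partial>lborel)\<^sup>2 * (\<integral>\<^sup>+x. ennreal ((g x)\<^sup>2) \<partial>lborel)"
    by (rule Young_nn_integral) auto
  also have "\<dots> < \<infinity>"
  proof -
    have "(\<integral>\<^sup>+x. ennreal \<bar>k x\<bar> \<partial>lborel) < \<infinity>" "(\<integral>\<^sup>+x. ennreal ((g x)\<^sup>2) \<partial>lborel) < \<infinity>"
      using ki gi by (auto simp: integrable_iff_bounded)
    then show ?thesis by (auto simp: ennreal_mult_less_top power_less_top_ennreal)
  qed
  finally have "AE x in lborel. (?N x)\<^sup>2 \<noteq> \<infinity>"
    by (intro nn_integral_PInf_AE) auto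
  then have "AE x in lebesgue. (?N x)\<^sup>2 \<noteq> \<infinity>" by (rule AE_completion)
  then show ?thesis
  proof eventually_elim
    case (elim x)
    then have "?N x < \<infinity>" by (auto simp: less_top power2_eq_square ennreal_mult_eq_top_iff)
    then have "integrable lborel (\<lambda>y. k (x - y) * g y)"
      by (simp add: integrable_iff_bounded)
    then have "integrable lebesgue (\<lambda>y. k (x - y) * g y)"
      by (subst integrable_completion) simp_all
    moreover have "AE y in lebesgue. K (x - y) * f y = k (x - y) * g y"
    proof -
      have "AE y in lebesgue. K (x - y) = k (x - y)"
        using Kk unfolding AE_completion_iff by (rule AE_lborel_reflect)
      with fg show ?thesis by eventually_elim simp
    qed
    ultimately show ?case by (rule integrable_lebesgue_cong_AE[rotated])
  qed
qed

lemma convolution_diff: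
  assumes "K \<in> L1" "f \<in> L2" "g \<in> L2"
  shows "AE x in lebesgue. convolution K (\<lambda>y. f y - g y) x = convolution K f x - convolution K g x"
  using AE_convolution_integrable[OF assms(1,2)] AE_convolution_integrable[OF assms(1,3)]
  by eventually_elim (simp add: convolution_def right_diff_distrib)

section \<open>Continuously differentiable functions on a ball\<close>

text \<open>
  Two derivatives of \<open>f\<close> at \<open>z\<close> agree on every direction \<open>w -
  z\<close> with \<open>w\<close> in \<open>S\<close>, since the segment from \<open>z\<close> to
  \<open>w\<close> lies in \<open>S\<close>. As \<open>w\<close> varies over a ball in
  \<open>S\<close>, the differences of such directions cover, up to scaling, all directions. This
  covers boundary points of a ball, where segments parallel to the coordinate axes may leave the
  ball at once.
\<close>

lemma has_derivative_within_convex_unique: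
  fixes f :: "'a::euclidean_space \<Rightarrow> real"
  assumes S: "convex S" "interior S \<noteq> {}" and z: "z \<in> S"
    and D: "(f has_derivative D) (at z within S)" and E: "(f has_derivative E) (at z within S)"
  shows "D = E"
proof -
  define L where "L h = D h - E h" for h
  have lin: "linear L"
    using has_derivative_linear[OF D] has_derivative_linear[OF E] unfolding L_def by (rule linear_compose_sub)
  have zero: "L (w - z) = 0" if w: "w \<in> S" for w
  proof -
    let ?p = "\<lambda>t::real. z + t *\<^sub>R (w - z)"
    have sub: "?p ` {0..1} \<subseteq> S"
    proof
      fix x assume "x \<in> ?p ` {0..1}"
      then obtain t where t: "x = z + t *\<^sub>R (w - z)" "t \<in> {0..1}" by blast
      have "z + t *\<^sub>R (w - z) = (1 - t) *\<^sub>R z + t *\<^sub>R w" by (simp add: algebra_simps)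
      then show "x \<in> S" using convexD[OF S(1) z w, of "1 - t" t] t by auto
    qed
    have p: "(?p has_derivative (\<lambda>t. t *\<^sub>R (w - z))) (at 0 within {0..1})"
      by (auto intro!: derivative_eq_intros)
    have "((\<lambda>t. f (?p t)) has_derivative (\<lambda>t. F (t *\<^sub>R (w - z)))) (at 0 within {0..1})"
      if "(f has_derivative F) (at z within S)" for F
      using has_derivative_in_compose[OF p, of f F] has_derivative_subset[OF that sub] by simp
    from this[OF D] this[OF E] have "((\<lambda>t. f (?p t)) has_vector_derivative D (w - z)) (at 0 within {0..1})"
      "((\<lambda>t. f (?p t)) has_vector_derivative E (w - z)) (at 0 within {0..1})"
      unfolding has_vector_derivative_def
      using linear_cmul[OF has_derivative_linear[OF D]] linear_cmul[OF has_derivative_linear[OF E]] by auto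
    then have "D (w - z) = E (w - z)"
      by (intro vector_derivative_unique_within_closed_interval[of 0 1 0]) auto
    then show ?thesis by (simp add: L_def)
  qed
  obtain w e where we: "0 < e" "ball w e \<subseteq> S"
    using S(2) by (auto simp: mem_interior)
  have "L h = 0" for h
  proof -
    obtain t where t: "t > 0" "w + t *\<^sub>R h \<in> ball w e"
    proof
      show "e / (2 * (norm h + 1)) > 0" using we(1) by (simp add: add_nonneg_pos)
      have "e / (2 * (norm h + 1)) * norm h < e"
      proof -
        have "e / (2 * (norm h + 1)) * norm h \<le> e / (2 * (norm h + 1)) * (norm h + 1)"
          using we(1) by (intro mult_left_mono) auto
        also have "\<dots> = e / 2"
          using norm_ge_zero[of h] by (simp add: field_simps add_nonneg_eq_0_iff)
        finally have "e / (2 * (norm h + 1)) * norm h \<le> e / 2" .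
        also have "\<dots> < e" using we(1) by simp
        finally show ?thesis .
      qed
      then show "w + (e / (2 * (norm h + 1))) *\<^sub>R h \<in> ball w e"
        using we(1) by (simp add: dist_norm)
    qed
    have "w \<in> S" using we by auto
    then have "L (w + t *\<^sub>R h - z) - L (w - z) = 0"
      using zero t(2) we(2) by auto
    then have "L (t *\<^sub>R h) = 0"
      by (simp flip: linear_diff[OF lin])
    then show ?thesis using t(1) by (simp add: linear_cmul[OF lin])
  qed
  then show ?thesis by (auto simp: L_def fun_eq_iff)
qed

lemma abs_le_C_norm:
  assumes "compact S" "continuous_on S f" "x \<in> S"
  shows "\<bar>f x\<bar> \<le> C_norm S f"
  unfolding C_norm_def
proof (rule cSUP_upper[OF assms(3)])
  have "compact ((\<lambda>z. \<bar>f z\<bar>) ` S)"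
    using assms by (intro compact_continuous_image continuous_intros)
  then show "bdd_above ((\<lambda>z. \<bar>f z\<bar>) ` S)"
    by (intro bounded_imp_bdd_above compact_imp_bounded)
qed

lemma C_norm_nonneg:
  assumes "compact S" "continuous_on S f" "S \<noteq> {}"
  shows "0 \<le> C_norm S f"
  using assms abs_le_C_norm[OF assms(1,2)] by (meson abs_ge_zero ex_in_conv order_trans)

lemma C1_norm_nonneg:
  assumes "compact S" "C1_on S f" "S \<noteq> {}"
  shows "0 \<le> C1_norm S f"
  using assms unfolding C1_norm_def C1_on_def
  by (intro add_nonneg_nonneg sum_nonneg C_norm_nonneg) (auto intro: differentiable_imp_continuous_on)

text \<open>
  The mean value inequality on a convex set: the operator norm of the derivative is at most the sum
  of the absolute values of the partial derivatives.
\<close>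

lemma C1_on_Lipschitz:
  assumes S: "compact S" "convex S" and f: "C1_on S f" and x: "x \<in> S" and y: "y \<in> S"
  shows "\<bar>f x - f y\<bar> \<le> C1_norm S f * norm (x - y)"
proof -
  let ?f' = "\<lambda>z. frechet_derivative f (at z within S)"
  have d: "(f has_derivative ?f' z) (at z within S)" if "z \<in> S" for z
    using f that by (auto simp: C1_on_def differentiable_on_def frechet_derivative_works)
  have "onorm (?f' z) \<le> C1_norm S f" if z: "z \<in> S" for z
  proof (rule onorm_le)
    fix h
    have lin: "linear (?f' z)" using d[OF z] by (rule has_derivative_linear)
    have "?f' z h = ?f' z (\<Sum>n\<in>UNIV. h $ n *\<^sub>R axis n 1)"
      by (simp add: basis_expansion flip: scalar_mult_eq_scaleR)
    also have "\<dots> = (\<Sum>n\<in>UNIV. h $ n * partial_on S n f z)"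
      by (simp add: linear_sum[OF lin] linear_cmul[OF lin] partial_on_def)
    finally have "norm (?f' z h) = \<bar>\<Sum>n\<in>UNIV. h $ n * partial_on S n f z\<bar>" by simp
    also have "\<dots> \<le> (\<Sum>n\<in>UNIV. \<bar>h $ n * partial_on S n f z\<bar>)" by (rule sum_abs)
    also have "\<dots> \<le> (\<Sum>n\<in>UNIV. norm h * C_norm S (partial_on S n f))"
      unfolding abs_mult using f
      by (intro sum_mono mult_mono component_le_norm_cart abs_le_C_norm[OF S(1) _ z]) (auto simp: C1_on_def)
    also have "\<dots> = (\<Sum>n\<in>UNIV. C_norm S (partial_on S n f)) * norm h"
      by (simp add: sum_distrib_left mult.commute)
    also have "\<dots> \<le> C1_norm S f * norm h"
      unfolding C1_norm_def using C_norm_nonneg[OF S(1), of f] f z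
      by (intro mult_right_mono) (auto simp: C1_on_def intro: differentiable_imp_continuous_on)
    finally show "norm (?f' z h) \<le> C1_norm S f * norm h" .
  qed
  then have "norm (f x - f y) \<le> C1_norm S f * norm (x - y)"
    using differentiable_bound[OF S(2) d _ x y] by blast
  then show ?thesis by simp
qed

text \<open>
  Uniqueness of derivatives is what makes \<open>partial_on\<close> additive: the derivative of the
  difference is chosen independently of the derivatives of \<open>f\<close> and \<open>g\<close>.
\<close>

lemma C1_on_diff:
  assumes S: "convex S" "interior S \<noteq> {}" and f: "C1_on S f" and g: "C1_on S g"
  shows "C1_on S (\<lambda>z. f z - g z)"
proof -
  have diff: "f differentiable_on S" "g differentiable_on S"
    and cont: "continuous_on S (partial_on S n f)" "continuous_on S (partial_on S n g)" for n
    using f g by (auto simp: C1_on_def)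
  have d: "(\<lambda>z. f z - g z) differentiable_on S"
    using diff by (rule differentiable_on_diff)
  have "partial_on S n (\<lambda>z. f z - g z) z = partial_on S n f z - partial_on S n g z" if z: "z \<in> S" for n z
  proof -
    have "((\<lambda>z. f z - g z) has_derivative
        (\<lambda>h. frechet_derivative f (at z within S) h - frechet_derivative g (at z within S) h)) (at z within S)"
      using diff z by (intro has_derivative_diff) (auto simp: differentiable_on_def frechet_derivative_works)
    moreover have "((\<lambda>z. f z - g z) has_derivative frechet_derivative (\<lambda>z. f z - g z) (at z within S)) (at z within S)"
      using d z by (simp add: differentiable_on_def frechet_derivative_works)
    ultimately have "frechet_derivative (\<lambda>z. f z - g z) (at z within S) =
        (\<lambda>h. frechet_derivative f (at z within S) h - frechet_derivative g (at z within S) h)"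
      by (intro has_derivative_within_convex_unique[OF S z])
    then show ?thesis by (simp add: partial_on_def)
  qed
  then have "continuous_on S (partial_on S n (\<lambda>z. f z - g z))" for n
    using continuous_on_diff[OF cont, of n] by (subst continuous_on_cong[OF refl]) auto
  then show ?thesis using d by (simp add: C1_on_def)
qed

section \<open>Convolution and superposition in \<open>H\<^sup>2\<close>\<close>

text \<open>
  The Laplacian of the convolution falls on the kernel, so \<open>f\<close> need only be in
  \<open>L\<^sup>2\<close>. This gain of two derivatives is the reason why the nonlinearity is only
  ever measured in \<open>L\<^sup>2\<close>.
\<close>

lemma convolution_H2:
  assumes K: "K \<in> W21" and f: "f \<in> L2"
  shows "convolution K f \<in> H2" "H2_norm (convolution K f) \<le> W21_norm K * L2_norm f"
proof -
  obtain h where h: "K \<in> L1" "h \<in> L1" "K has_weak_laplacian h"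
    using K by (auto simp: W21_def)
  have "L1_norm (laplacian K) = L1_norm h"
    unfolding L1_norm_def using laplacian_eq_AE[OF h(3)] by (auto intro!: integral_lebesgue_cong_AE)
  then have W: "W21_norm K = sqrt ((L1_norm K)\<^sup>2 + (L1_norm h)\<^sup>2)"
    by (simp add: W21_norm_def)
  note c = H2_normI[OF convolution_L2(1)[OF h(1) f] convolution_L2(1)[OF h(2) f]
      convolution_has_weak_laplacian[OF h f]]
  show "convolution K f \<in> H2" by (rule c)
  have "H2_norm (convolution K f) \<le> sqrt ((L1_norm K * L2_norm f)\<^sup>2 + (L1_norm h * L2_norm f)\<^sup>2)"
    unfolding c(2)
    by (intro real_sqrt_le_mono add_mono power_mono convolution_L2(2) h f L2_norm_nonneg)
  also have "\<dots> = sqrt (((L1_norm K)\<^sup>2 + (L1_norm h)\<^sup>2) * (L2_norm f)\<^sup>2)"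
    by (simp add: power_mult_distrib distrib_right)
  also have "\<dots> = W21_norm K * L2_norm f"
    by (simp add: W real_sqrt_mult L2_norm_nonneg)
  finally show "H2_norm (convolution K f) \<le> W21_norm K * L2_norm f" .
qed

lemma W21_norm_nonneg: "0 \<le> W21_norm K"
  by (simp add: W21_norm_def)

lemma vec_H2_borel_measurable:
  fixes u :: "real^'d::finite \<Rightarrow> real^'N::finite"
  assumes "u \<in> vec_H2"
  shows "u \<in> borel_measurable lebesgue"
proof -
  have "(\<lambda>x. u x \<bullet> b) \<in> borel_measurable lebesgue" if b: "b \<in> Basis" for b
  proof -
    obtain m where "b = axis m 1" using b by (auto simp: Basis_vec_def)
    then show ?thesis using assms by (simp add: inner_axis vec_H2_def H2_def L2_def)
  qed
  then show ?thesis by (subst borel_measurable_euclidean_space) auto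
qed

text \<open>
  The embedding constant, stated for scalar functions, serves vector functions unchanged, because
  the norm of a vector function is the Euclidean length of the vector of component norms.
\<close>

lemma AE_norm_le_embedding:
  fixes u :: "real^'d::finite \<Rightarrow> real^'N::finite"
  assumes c: "is_embedding_const TYPE('d) c" and u: "u \<in> vec_H2"
  shows "AE x in lebesgue. norm (u x) \<le> c * vec_H2_norm u"
proof -
  have c0: "c > 0" using c by (simp add: is_embedding_const_def)
  have "AE x in lebesgue. \<bar>u x $ m\<bar> \<le> c * H2_norm (\<lambda>x. u x $ m)" for m
  proof -
    have "esssup lebesgue (\<lambda>x. ereal \<bar>u x $ m\<bar>) \<le> ereal (c * H2_norm (\<lambda>x. u x $ m))"
      using c u by (auto simp: is_embedding_const_def vec_H2_def)
    with esssup_AE[of "\<lambda>x. ereal \<bar>u x $ m\<bar>" lebesgue] show ?thesis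
      by (auto elim!: eventually_mono dest: order_trans)
  qed
  then have "AE x in lebesgue. \<forall>m\<in>UNIV. \<bar>u x $ m\<bar> \<le> c * H2_norm (\<lambda>x. u x $ m)"
    by (intro AE_finite_allI) auto
  then show ?thesis
  proof eventually_elim
    case (elim x)
    have "norm (u x) \<le> L2_set (\<lambda>m. c * H2_norm (\<lambda>x. u x $ m)) UNIV"
      unfolding norm_vec_def using elim by (intro L2_set_mono) auto
    also have "\<dots> = c * vec_H2_norm u"
      unfolding vec_H2_norm_eq using c0 by (intro L2_set_right_distrib[symmetric]) simp
    finally show ?case .
  qed
qed

text \<open>
  Outside \<open>S\<close> the function \<open>f\<close> is arbitrary and may fail to be measurable;
  composed with \<open>u\<close> it can be replaced there by \<open>0\<close>.
\<close>

lemma superposition_measurable: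
  fixes f :: "'a::euclidean_space \<Rightarrow> real" and u :: "'b::euclidean_space \<Rightarrow> 'a"
  assumes "closed S" "continuous_on S f" "u \<in> borel_measurable lebesgue" "AE x in lebesgue. u x \<in> S"
  shows "(\<lambda>x. f (u x)) \<in> borel_measurable lebesgue"
proof (rule borel_measurable_lebesgue_cong_AE)
  have "(\<lambda>z. indicator S z *\<^sub>R f z) \<in> borel_measurable borel"
    using assms by (intro borel_measurable_continuous_on_indicator) auto
  with assms(3) show "(\<lambda>x. indicator S (u x) *\<^sub>R f (u x)) \<in> borel_measurable lebesgue"
    by (rule measurable_compose)
  show "AE x in lebesgue. f (u x) = indicator S (u x) *\<^sub>R f (u x)"
    using assms(4) by eventually_elim simp
qed

lemma superposition_Lipschitz:
  fixes u v :: "real^'d::finite \<Rightarrow> real^'N::finite"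
  assumes S: "compact S" "convex S" and f: "C1_on S f"
    and u: "u \<in> borel_measurable lebesgue" "AE x in lebesgue. u x \<in> S"
    and v: "v \<in> borel_measurable lebesgue" "AE x in lebesgue. v x \<in> S"
    and uv: "(\<lambda>x. u x - v x) \<in> vec_H2"
  shows "(\<lambda>x. f (u x) - f (v x)) \<in> L2"
    and "L2_norm (\<lambda>x. f (u x) - f (v x)) \<le> C1_norm S f * vec_H2_norm (\<lambda>x. u x - v x)"
proof -
  have cont: "continuous_on S f"
    using f by (auto simp: C1_on_def intro: differentiable_imp_continuous_on)
  have m: "(\<lambda>x. f (u x) - f (v x)) \<in> borel_measurable lebesgue"
    using u v S(1) cont
    by (intro borel_measurable_diff superposition_measurable[of S f]) (auto intro: compact_imp_closed)
  have g: "(\<lambda>x. C1_norm S f * norm (u x - v x)) \<in> L2"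
    "L2_norm (\<lambda>x. C1_norm S f * norm (u x - v x)) = \<bar>C1_norm S f\<bar> * L2_norm (\<lambda>x. norm (u x - v x))"
    using L2_cmult L2_norm_cmult norm_L2_le_vec_H2_norm(1)[OF uv] by blast+
  have le: "AE x in lebesgue. \<bar>f (u x) - f (v x)\<bar> \<le> C1_norm S f * norm (u x - v x)"
    using u(2) v(2) by eventually_elim (rule C1_on_Lipschitz[OF S f])
  show "(\<lambda>x. f (u x) - f (v x)) \<in> L2" by (rule L2_dominated(1)[OF m g(1) le])
  have S0: "S \<noteq> {}"
  proof
    assume "S = {}"
    with u(2) have "AE x in (lebesgue :: (real^'d) measure). False" by simp
    then show False by (simp add: AE_iff_null null_sets_def)
  qed
  have "L2_norm (\<lambda>x. f (u x) - f (v x)) \<le> C1_norm S f * L2_norm (\<lambda>x. norm (u x - v x))"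
    using L2_norm_mono[OF m g(1) le] g(2) C1_norm_nonneg[OF S(1) f S0] by simp
  also have "\<dots> \<le> C1_norm S f * vec_H2_norm (\<lambda>x. u x - v x)"
    by (intro mult_left_mono norm_L2_le_vec_H2_norm(2)[OF uv] C1_norm_nonneg[OF S(1) f S0])
  finally show "L2_norm (\<lambda>x. f (u x) - f (v x)) \<le> C1_norm S f * vec_H2_norm (\<lambda>x. u x - v x)" .
qed

text \<open>
  The Lipschitz estimate, applied to \<open>u\<close> and the zero function.
\<close>

lemma superposition_L2:
  fixes u :: "real^'d::finite \<Rightarrow> real^'N::finite"
  assumes S: "compact S" "convex S" and f: "C1_on S f" and f0: "0 \<in> S" "f 0 = 0"
    and u: "u \<in> vec_H2" "AE x in lebesgue. u x \<in> S"
  shows "(\<lambda>x. f (u x)) \<in> L2" and "L2_norm (\<lambda>x. f (u x)) \<le> C1_norm S f * vec_H2_norm u"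
  using superposition_Lipschitz[OF S f vec_H2_borel_measurable[OF u(1)] u(2), of "\<lambda>x. 0"] f0 u(1)
  by simp_all

text \<open>
  The product rule for differences, \<open>T \<phi> * (K \<star> F) - T \<psi> * (K \<star> G) = T
  (\<phi> - \<psi>) * (K \<star> F) + T \<psi> * (K \<star> (F - G))\<close> with
  \<open>\<star>\<close> for the convolution, followed by the algebra property for each of the two
  products.
\<close>

lemma H2_norm_product_difference:
  fixes T :: "(real^'d::finite \<Rightarrow> real) \<Rightarrow> real^'d \<Rightarrow> real"
  assumes ca: "is_algebra_const TYPE('d) c" and T: "H2_bounded_linear T" and K: "K \<in> W21"
    and \<phi>: "\<phi> \<in> H2" and \<psi>: "\<psi> \<in> H2" and F: "F \<in> L2" and G: "G \<in> L2"
    and FG: "(\<lambda>x. F x - G x) \<in> L2" and T0: "0 \<le> H2_onorm T"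
    and w: "AE x in lebesgue. w x = T \<phi> x * convolution K F x - T \<psi> x * convolution K G x"
  shows "H2_norm w \<le> c * (H2_onorm T * W21_norm K) *
    (H2_norm (\<lambda>x. \<phi> x - \<psi> x) * L2_norm F + H2_norm \<psi> * L2_norm (\<lambda>x. F x - G x))"
proof -
  have c0: "c > 0" using ca by (simp add: is_algebra_const_def)
  have prod: "(\<lambda>x. T \<theta> x * convolution K E x) \<in> H2"
    "H2_norm (\<lambda>x. T \<theta> x * convolution K E x) \<le> c * (H2_onorm T * W21_norm K) * (H2_norm \<theta> * L2_norm E)"
    if \<theta>: "\<theta> \<in> H2" and E: "E \<in> L2" for \<theta> E
  proof -
    note t = H2_norm_bounded_linear[OF T \<theta>] and k = convolution_H2[OF K E]
    show "(\<lambda>x. T \<theta> x * convolution K E x) \<in> H2"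
      using ca t(1) k(1) by (simp add: is_algebra_const_def)
    have "H2_norm (\<lambda>x. T \<theta> x * convolution K E x) \<le> c * H2_norm (T \<theta>) * H2_norm (convolution K E)"
      using ca t(1) k(1) by (simp add: is_algebra_const_def)
    also have "\<dots> \<le> c * (H2_onorm T * H2_norm \<theta>) * (W21_norm K * L2_norm E)"
      using c0 T0 by (intro mult_mono t(2) k(2) mult_nonneg_nonneg H2_norm_nonneg) auto
    finally show "H2_norm (\<lambda>x. T \<theta> x * convolution K E x)
        \<le> c * (H2_onorm T * W21_norm K) * (H2_norm \<theta> * L2_norm E)"
      by (simp add: algebra_simps)
  qed
  have d: "(\<lambda>x. \<phi> x - \<psi> x) \<in> H2" by (rule H2_diff[OF \<phi> \<psi>])
  have K1: "K \<in> L1" using K by (simp add: W21_def)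
  let ?A = "\<lambda>x. T (\<lambda>y. \<phi> y - \<psi> y) x * convolution K F x"
  let ?B = "\<lambda>x. T \<psi> x * convolution K (\<lambda>y. F y - G y) x"
  have "AE x in lebesgue. w x = ?A x + ?B x"
    using w H2_bounded_linear_diff[OF T \<phi> \<psi>] convolution_diff[OF K1 F G]
    by eventually_elim (simp only:, simp add: algebra_simps)
  then have "H2_norm w = H2_norm (\<lambda>x. ?A x + ?B x)"
    by (rule H2_norm_cong_AE[OF H2_add(1)[OF prod(1)[OF d F] prod(1)[OF \<psi> FG]]])
  also have "\<dots> \<le> H2_norm ?A + H2_norm ?B"
    by (rule H2_norm_triangle[OF prod(1)[OF d F] prod(1)[OF \<psi> FG]])
  also have "\<dots> \<le> c * (H2_onorm T * W21_norm K) * (H2_norm (\<lambda>x. \<phi> x - \<psi> x) * L2_norm F)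
      + c * (H2_onorm T * W21_norm K) * (H2_norm \<psi> * L2_norm (\<lambda>x. F x - G x))"
    by (intro add_mono prod(2) d F \<psi> FG)
  finally show ?thesis by (simp add: distrib_left)
qed

lemma Q_const_eq: "Q_const T K = L2_set (\<lambda>m. H2_onorm (T m) * W21_norm (K m)) UNIV"
  by (simp add: Q_const_def L2_set_def power_mult_distrib)

lemma fixed_point_equation:
  assumes "is_fixed_point_in B (t_map T K u\<^sub>0 g) v"
  shows "AE x in lebesgue. (u\<^sub>0 x + v x) $ m = u\<^sub>0 x $ m +
    T m (\<lambda>y. (u\<^sub>0 y + v y) $ m) x * convolution (K m) (\<lambda>y. g (u\<^sub>0 y + v y) $ m) x"
proof -
  have "AE x in lebesgue. t_map T K u\<^sub>0 g v x = v x"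
    using assms by (simp add: is_fixed_point_in_def)
  then show ?thesis
  proof eventually_elim
    case (elim x)
    then have "v x $ m = t_map T K u\<^sub>0 g v x $ m" by simp
    then show ?case by (simp add: t_map_def convolution_def)
  qed
qed

theorem theorem1p4:
  fixes K :: "'N::finite \<Rightarrow> real^'d::finite \<Rightarrow> real"
    and T :: "'N \<Rightarrow> (real^'d \<Rightarrow> real) \<Rightarrow> (real^'d \<Rightarrow> real)"
    and u\<^sub>0 u\<^sub>p\<^sub>1 u\<^sub>p\<^sub>2 u\<^sub>1 u\<^sub>2 :: "real^'d \<Rightarrow> real^'N"
    and g\<^sub>1 g\<^sub>2 :: "real^'N \<Rightarrow> real^'N"
    and \<rho> M c\<^sub>e c\<^sub>a \<sigma> :: real
  assumes dim: "CARD('d) \<in> {2, 3}"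
    and ce: "is_embedding_const TYPE('d) c\<^sub>e"
    and ca: "is_algebra_const TYPE('d) c\<^sub>a"
    and rho: "0 < \<rho>" "\<rho> \<le> 1"
    and M: "M > 0"
    and K: "\<And>m. K m \<in> W21" "\<And>m. \<not> (AE x in lebesgue. K m x = 0)"
    and u0: "u\<^sub>0 \<in> vec_H2" "\<exists>m. \<not> (AE x in lebesgue. u\<^sub>0 x $ m = 0)"
    and T: "\<And>m. H2_bounded_linear (T m)" "\<And>m. 0 < H2_onorm (T m)"
    and g1: "g\<^sub>1 0 = 0" "g\<^sub>1 \<in> D_set (I_ball c\<^sub>e u\<^sub>0) M" "\<exists>z \<in> I_ball c\<^sub>e u\<^sub>0. g\<^sub>1 z \<noteq> 0"
    and g2: "g\<^sub>2 0 = 0" "g\<^sub>2 \<in> D_set (I_ball c\<^sub>e u\<^sub>0) M" "\<exists>z \<in> I_ball c\<^sub>e u\<^sub>0. g\<^sub>2 z \<noteq> 0"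
    and small: "c\<^sub>a * M * (vec_H2_norm u\<^sub>0 + 1)\<^sup>2 * Q_const T K \<le> \<rho> / 2"
    and up1: "is_fixed_point_in (B_ball \<rho>) (t_map T K u\<^sub>0 g\<^sub>1) u\<^sub>p\<^sub>1"
    and up2: "is_fixed_point_in (B_ball \<rho>) (t_map T K u\<^sub>0 g\<^sub>2) u\<^sub>p\<^sub>2"
    and u1: "u\<^sub>1 = (\<lambda>x. u\<^sub>0 x + u\<^sub>p\<^sub>1 x)"
    and u2: "u\<^sub>2 = (\<lambda>x. u\<^sub>0 x + u\<^sub>p\<^sub>2 x)"
    and sigma: "\<sigma> = 2 * c\<^sub>a * Q_const T K * M * (vec_H2_norm u\<^sub>0 + 1)"
  shows "vec_H2_norm (\<lambda>x. u\<^sub>1 x - u\<^sub>2 x) \<le>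
           \<sigma> / (2 * M * (1 - \<sigma>)) * (vec_H2_norm u\<^sub>0 + 1) *
             vec_C1_norm (I_ball c\<^sub>e u\<^sub>0) (\<lambda>z. g\<^sub>1 z - g\<^sub>2 z)"
proof -
  define U where "U = vec_H2_norm u\<^sub>0 + 1"
  define S where "S = I_ball c\<^sub>e u\<^sub>0"
  define Q where "Q = Q_const T K"
  define D where "D = vec_C1_norm S (\<lambda>z. g\<^sub>1 z - g\<^sub>2 z)"
  define \<delta> where "\<delta> = vec_H2_norm (\<lambda>x. u\<^sub>1 x - u\<^sub>2 x)"
  have \<sigma>: "\<sigma> = 2 * c\<^sub>a * Q * M * U" by (simp add: sigma U_def Q_def)
  have small': "c\<^sub>a * M * U\<^sup>2 * Q \<le> \<rho> / 2" using small by (simp add: U_def Q_def)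
  have ca0: "c\<^sub>a > 0" and ce0: "c\<^sub>e > 0"
    using ca ce by (auto simp: is_algebra_const_def is_embedding_const_def)
  \<comment> \<open>Nontriviality of \<open>u\<^sub>0\<close> enters here: \<open>U > 1\<close> will turn \<open>\<sigma> * U \<le> 1\<close> into \<open>\<sigma> < 1\<close>.\<close>
  have "U > 1" using vec_H2_norm_pos[OF u0(1)] u0(2) by (auto simp: U_def)
  have "S = cball 0 (c\<^sub>e * U)" by (auto simp: S_def I_ball_def U_def)
  moreover have "c\<^sub>e * U > 0" using ce0 \<open>U > 1\<close> by simp
  ultimately have S: "compact S" "convex S" "interior S \<noteq> {}" "0 \<in> S" "S \<noteq> {}"
    by (auto simp: interior_cball)

  have u_H2: "u \<in> vec_H2" "vec_H2_norm u \<le> U" "AE x in lebesgue. u x \<in> S"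
    if "v \<in> B_ball \<rho>" "u = (\<lambda>x. u\<^sub>0 x + v x)" for u v
  proof -
    have v: "v \<in> vec_H2" "vec_H2_norm v \<le> 1" using that(1) rho by (auto simp: B_ball_def)
    show u: "u \<in> vec_H2" unfolding that(2) by (rule vec_H2_add(1)[OF u0(1) v(1)])
    show le: "vec_H2_norm u \<le> U"
      using vec_H2_norm_triangle[OF u0(1) v(1)] v(2) by (simp add: that(2) U_def)
    have "c\<^sub>e * vec_H2_norm u \<le> c\<^sub>e * U" using le ce0 by simp
    with AE_norm_le_embedding[OF ce u] show "AE x in lebesgue. u x \<in> S"
      by (auto elim!: eventually_mono simp: S_def I_ball_def U_def)
  qed
  note u1' = u_H2[of u\<^sub>p\<^sub>1, OF _ u1] and u2' = u_H2[of u\<^sub>p\<^sub>2, OF _ u2]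
  have B: "u\<^sub>p\<^sub>1 \<in> B_ball \<rho>" "u\<^sub>p\<^sub>2 \<in> B_ball \<rho>" using up1 up2 by (auto simp: is_fixed_point_in_def)
  note u1' = u1'[OF B(1)] and u2' = u2'[OF B(2)]
  have comp: "(\<lambda>x. u\<^sub>1 x $ m) \<in> H2" "(\<lambda>x. u\<^sub>2 x $ m) \<in> H2" for m
    using u1'(1) u2'(1) by (auto simp: vec_H2_def)
  have u12: "(\<lambda>x. u\<^sub>1 x - u\<^sub>2 x) \<in> vec_H2"
    using H2_diff[OF comp] by (simp add: vec_H2_def)

  have C1: "C1_on S (\<lambda>z. g\<^sub>1 z $ m)" "C1_on S (\<lambda>z. g\<^sub>2 z $ m)" for m
    using g1(2) g2(2) by (auto simp: D_set_def S_def)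
  have C1d: "C1_on S (\<lambda>z. (g\<^sub>1 z - g\<^sub>2 z) $ m)" for m
    using C1_on_diff[OF S(2,3) C1] by simp
  have g1M: "C1_norm S (\<lambda>z. g\<^sub>1 z $ m) \<le> M" for m
  proof -
    have "C1_norm S (\<lambda>z. g\<^sub>1 z $ m) \<le> vec_C1_norm S g\<^sub>1"
      unfolding vec_C1_norm_def by (rule member_le_sum) (simp_all add: C1_norm_nonneg[OF S(1) C1(1) S(5)])
    then show ?thesis using g1(2) by (simp add: D_set_def S_def)
  qed
  have gD: "C1_norm S (\<lambda>z. (g\<^sub>1 z - g\<^sub>2 z) $ m) \<le> D" for m
    unfolding vec_C1_norm_def D_def by (rule member_le_sum) (simp_all add: C1_norm_nonneg[OF S(1) C1d S(5)] del: vector_minus_component)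
  have \<delta>0: "0 \<le> \<delta>" by (simp add: \<delta>_def vec_H2_norm_nonneg)
  have D0: "0 \<le> D" using gD C1_norm_nonneg[OF S(1) C1d S(5)] order_trans by blast

  \<comment> \<open>The term \<open>2 * M * U * \<delta>\<close> collects one \<open>M * U * \<delta>\<close> from the linear factor \<open>T\<close> and one from the nonlinearity.\<close>
  have comp_le: "H2_norm (\<lambda>x. (u\<^sub>1 x - u\<^sub>2 x) $ m) \<le>
      (H2_onorm (T m) * W21_norm (K m)) * (c\<^sub>a * (2 * M * U * \<delta> + D * U\<^sup>2))" for m
  proof -
    let ?F = "\<lambda>x. g\<^sub>1 (u\<^sub>1 x) $ m" and ?G = "\<lambda>x. g\<^sub>2 (u\<^sub>2 x) $ m"
    have F: "?F \<in> L2" "L2_norm ?F \<le> C1_norm S (\<lambda>z. g\<^sub>1 z $ m) * vec_H2_norm u\<^sub>1"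
      by (rule superposition_L2[OF S(1,2) C1(1) S(4) _ u1'(1,3)], simp add: g1)+
    have G: "?G \<in> L2"
      by (rule superposition_L2[OF S(1,2) C1(2) S(4) _ u2'(1,3)], simp add: g2)
    let ?F12 = "\<lambda>x. g\<^sub>1 (u\<^sub>1 x) $ m - g\<^sub>1 (u\<^sub>2 x) $ m" and ?G12 = "\<lambda>x. (g\<^sub>1 (u\<^sub>2 x) - g\<^sub>2 (u\<^sub>2 x)) $ m"
    have F12: "?F12 \<in> L2" "L2_norm ?F12 \<le> C1_norm S (\<lambda>z. g\<^sub>1 z $ m) * \<delta>"
      unfolding \<delta>_def
      by (rule superposition_Lipschitz[OF S(1,2) C1(1)
          vec_H2_borel_measurable[OF u1'(1)] u1'(3) vec_H2_borel_measurable[OF u2'(1)] u2'(3) u12])+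
    have G12: "?G12 \<in> L2" "L2_norm ?G12 \<le> C1_norm S (\<lambda>z. (g\<^sub>1 z - g\<^sub>2 z) $ m) * vec_H2_norm u\<^sub>2"
      by (rule superposition_L2[OF S(1,2) C1d S(4) _ u2'(1,3)], simp add: g1 g2)+
    \<comment> \<open>The nonlinear terms differ because the arguments differ and because the nonlinearities differ.\<close>
    have FG_eq: "(\<lambda>x. ?F x - ?G x) = (\<lambda>x. ?F12 x + ?G12 x)" by simp
    have FG: "(\<lambda>x. ?F x - ?G x) \<in> L2" unfolding FG_eq by (rule L2_add(1)[OF F12(1) G12(1)])
    have "L2_norm (\<lambda>x. ?F x - ?G x) \<le> L2_norm ?F12 + L2_norm ?G12"
      unfolding FG_eq by (rule L2_norm_triangle[OF F12(1) G12(1)])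
    also have "\<dots> \<le> M * \<delta> + D * U"
    proof (rule add_mono)
      show "L2_norm ?F12 \<le> M * \<delta>"
        using F12(2) mult_right_mono[OF g1M[of m] \<delta>0] by linarith
      have "C1_norm S (\<lambda>z. (g\<^sub>1 z - g\<^sub>2 z) $ m) * vec_H2_norm u\<^sub>2 \<le> D * U"
        by (intro mult_mono gD u2' D0 vec_H2_norm_nonneg)
      then show "L2_norm ?G12 \<le> D * U" using G12(2) by linarith
    qed
    finally have FG_le: "L2_norm (\<lambda>x. ?F x - ?G x) \<le> M * \<delta> + D * U" .
    have "C1_norm S (\<lambda>z. g\<^sub>1 z $ m) * vec_H2_norm u\<^sub>1 \<le> M * U"
      using M by (intro mult_mono g1M u1' vec_H2_norm_nonneg) simp
    then have F_le: "L2_norm ?F \<le> M * U" using F(2) by linarith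
    have "AE x in lebesgue. (u\<^sub>1 x - u\<^sub>2 x) $ m =
        T m (\<lambda>y. u\<^sub>1 y $ m) x * convolution (K m) ?F x - T m (\<lambda>y. u\<^sub>2 y $ m) x * convolution (K m) ?G x"
      using fixed_point_equation[OF up1, of m] fixed_point_equation[OF up2, of m]
      unfolding u1 u2 by eventually_elim simp
    then have "H2_norm (\<lambda>x. (u\<^sub>1 x - u\<^sub>2 x) $ m) \<le> c\<^sub>a * (H2_onorm (T m) * W21_norm (K m)) *
        (H2_norm (\<lambda>x. u\<^sub>1 x $ m - u\<^sub>2 x $ m) * L2_norm ?F
          + H2_norm (\<lambda>x. u\<^sub>2 x $ m) * L2_norm (\<lambda>x. ?F x - ?G x))"
      by (intro H2_norm_product_difference ca T K comp F(1) G FG less_imp_le)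
    also have "\<dots> \<le> c\<^sub>a * (H2_onorm (T m) * W21_norm (K m)) * (\<delta> * (M * U) + U * (M * \<delta> + D * U))"
    proof (intro mult_left_mono add_mono mult_mono F_le FG_le)
      show "H2_norm (\<lambda>x. u\<^sub>1 x $ m - u\<^sub>2 x $ m) \<le> \<delta>"
        using H2_norm_le_vec_H2_norm[of "\<lambda>x. u\<^sub>1 x - u\<^sub>2 x" m] by (simp add: \<delta>_def)
      show "H2_norm (\<lambda>x. u\<^sub>2 x $ m) \<le> U"
        using H2_norm_le_vec_H2_norm[of u\<^sub>2 m] u2'(2) by linarith
      show "0 \<le> c\<^sub>a * (H2_onorm (T m) * W21_norm (K m))"
        using ca0 T(2)[of m] W21_norm_nonneg[of "K m"] by (simp add: less_imp_le)
    qed (use \<delta>0 \<open>U > 1\<close> L2_norm_nonneg in auto)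
    finally show ?thesis by (simp add: algebra_simps power2_eq_square)
  qed
  let ?c = "c\<^sub>a * (2 * M * U * \<delta> + D * U\<^sup>2)"
  have c0: "0 \<le> ?c" using ca0 M \<open>U > 1\<close> \<delta>0 D0 by simp
  have "\<delta> = L2_set (\<lambda>m. H2_norm (\<lambda>x. (u\<^sub>1 x - u\<^sub>2 x) $ m)) UNIV"
    unfolding \<delta>_def by (rule vec_H2_norm_eq)
  also have "\<dots> \<le> L2_set (\<lambda>m. (H2_onorm (T m) * W21_norm (K m)) * ?c) UNIV"
    by (rule L2_set_mono[OF comp_le H2_norm_nonneg])
  also have "\<dots> = Q * ?c"
    unfolding Q_def Q_const_eq by (rule L2_set_left_distrib[OF c0, symmetric])
  finally have "\<delta> \<le> \<sigma> * \<delta> + c\<^sub>a * Q * U\<^sup>2 * D"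
    by (simp add: \<sigma> algebra_simps)
  then have main: "\<delta> * (1 - \<sigma>) \<le> c\<^sub>a * Q * U\<^sup>2 * D" by (simp add: algebra_simps)
  have "\<sigma> * U \<le> 1"
    using small' rho by (simp add: \<sigma> power2_eq_square algebra_simps)
  then have "\<sigma> \<le> 1 / U" using \<open>U > 1\<close> by (simp add: pos_le_divide_eq)
  also have "\<dots> < 1" using \<open>U > 1\<close> by simp
  finally have s1: "\<sigma> < 1" .
  have "\<sigma> / (2 * M * (1 - \<sigma>)) * U * D = c\<^sub>a * Q * U\<^sup>2 * D / (1 - \<sigma>)"
    using M s1 by (simp add: \<sigma> field_simps power2_eq_square)
  moreover have "\<delta> \<le> c\<^sub>a * Q * U\<^sup>2 * D / (1 - \<sigma>)"
    using main s1 by (simp add: pos_le_divide_eq)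
  ultimately show ?thesis by (simp add: \<delta>_def D_def S_def U_def)
qed

end
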